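(* Let $n$ be a positive integer, let $A\in M(n,\mathbb{Z})$, and let $\mu$ be a non-atomic $\times A$-invariant measure on $\mathbb{T}^n$. Suppose that $\mu$ satisfies one of the following conditions: (1) $\mu$ is ergodic (for $T_A$), and there exist $n$ matrices $B_1,B_2,\dots,B_n\in GL(n,\mathbb{Z})$ which are strongly independent over $\mathbb{Z}^n\setminus\{0\}$, a Følner sequence $\Sigma=\{F_m\}_{m=1}^\infty$ in $\mathbb{N}$ and a set $E\subseteq\mathbb{N}$ with $D_\Sigma(E)=1$ such that $\mu$ is $\times(A^j+B_i)$-invariant for all $j\in E$ and all $i=1,2,\dots,n$; (2) $\mu$ is weakly mixing (for $T_A$), and there exist $n$ matrices $B_1,B_2,\dots,B_n\in GL(n,\mathbb{Z})$ which are strongly independent over $\mathbb{Z}^n\setminus\{0\}$, a Følner sequence $\Sigma=\{F_m\}_{m=1}^\infty$ in $\mathbb{N}$ and a set $E\subseteq\mathbb{N}$ with $\overline{D}_\Sigma(E)>0$ such that $\mu$ is $\times(A^j+B_i)$-invariant for all $j\in E$ and all $i=1,2,\dots,n$; (3) $\mu$ is strongly mixing (for $T_A$), and there exist $n$ matrices $B_1,B_2,\dots,B_n\in GL(n,\mathbb{Z})$ which are strongly independent over $\mathbb{Z}^n\setminus\{0\}$ and an infinite set $E\subseteq\mathbb{N}$ such that $\mu$ is $\times(A^j+B_i)$-invariant for all $j\in E$ and all $i=1,2,\dots,n$. Then $\mu$ is the Lebesgue measure on $\mathbb{T}^n$. Moreover, any $\times A$-invariant measure on $\mathbb{T}^n$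 (not assumed non-atomic) satisfying (2) or (3) is either a Dirac measure or the Lebesgue measure.
   Context: $\mathbb{N}$ is the set of nonnegative integers. $M(n,\mathbb{Z})$ is the set of $n\times n$ integer matrices, and $GL(n,\mathbb{Z})$ is the set of matrices in $M(n,\mathbb{Z})$ that are invertible with inverse in $M(n,\mathbb{Z})$. $\mathbb{T}^n=\mathbb{R}^n/\mathbb{Z}^n$. "Measure" means Borel probability measure. A measure $\mu$ is non-atomic if $\mu(\{x\})=0$ for every point $x$. "Lebesgue measure" is the normalized Lebesgue (Haar) measure on $\mathbb{T}^n$. For $A\in M(n,\mathbb{Z})$ the $\times A$ map is $T_A:\mathbb{T}^n\to\mathbb{T}^n$, $T_A(x)=Ax \bmod \mathbb{Z}^n$ ($x$ a column vector). For a continuous map $T:X\to X$ of a compact metrizable space, $\mu$ is $T$-invariant if $\mu(T^{-1}E)=\mu(E)$ for every Borel $E$; "$\times A$-invariant" means $T_A$-invariant. A $T$-invariant measure $\mu$ is ergodic if every Borel $E$ with $T^{-1}E=E$ has $\mu(E)\in\{0,1\}$; weakly mixing if $\mu\times\mu$ is an ergodic $T\times T$-invariant measure on $X\times X$; strongly mixing if $\lim_{j\to\infty}\mu(T^{-j}E\cap F)=\mu(E)\mu(F)$ for all Borel $E,F$. Matrices $B_1,\dots,B_n\in GL(n,\mathbb{Z})$ are strongly independent over $\mathbb{Z}^n\setminus\{0\}$ if for every nonzero row vector $\vec{k}\in\mathbb{Z}^n$ the vectors $\vec{k}B_1,\dots,\vec{k}B_n$ are linearly independent over $\mathbb{R}$.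 A Følner sequence in $\mathbb{N}$ is a sequence $\Sigma=\{F_m\}_{m=1}^\infty$ of (nonempty) finite subsets of $\mathbb{N}$ with $\lim_{m\to\infty}\frac{|(F_m+r)\Delta F_m|}{|F_m|}=0$ for every $r\in\mathbb{N}$. For $E\subseteq\mathbb{N}$, the density is $D_\Sigma(E)=\lim_{m\to\infty}\frac{|E\cap F_m|}{|F_m|}$ (when the limit exists) and the upper density is $\overline{D}_\Sigma(E)=\limsup_{m\to\infty}\frac{|E\cap F_m|}{|F_m|}$. *)

theory Defs
  imports "HOL-Probability.Probability"
begin

quotient_type 'n torus = "real ^ 'n" / "\<lambda>x y. \<forall>i. x $ i - y $ i \<in> \<int>"
  morphisms rep_torus proj_torus
proof (rule equivpI)
  show "reflp (\<lambda>x y :: real ^ 'n. \<forall>i. x $ i - y $ i \<in> \<int>)"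
    by (simp add: reflp_def)
  show "symp (\<lambda>x y :: real ^ 'n. \<forall>i. x $ i - y $ i \<in> \<int>)"
    by (simp add: symp_def) (metis Ints_minus minus_diff_eq)
  show "transp (\<lambda>x y :: real ^ 'n. \<forall>i. x $ i - y $ i \<in> \<int>)"
    by (simp add: transp_def) (metis Ints_add diff_add_cancel add_diff_eq)
qed

instantiation torus :: (finite) topological_space
begin

text \<open>The quotient topology.\<close>

definition open_torus :: "'a torus set \<Rightarrow> bool" where
  "open_torus U \<longleftrightarrow> open (proj_torus -` U)"

instance
  by standard (auto simp: open_torus_def vimage_Union)

end

lemma continuous_proj_torus: "continuous_on UNIV proj_torus"
  by (simp add: continuous_on_open_vimage[OF open_UNIV] open_torus_def)

lemma measurable_proj_torus [measurable]: "proj_torus \<in> borel_measurable borel"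
  by (intro borel_measurable_continuous_onI continuous_proj_torus)

lemma Ints_matrix_vector_mult:
  fixes A :: "int ^ 'n ^ 'm" and x y :: "real ^ 'n"
  assumes "\<forall>i. x $ i - y $ i \<in> \<int>"
  shows "(map_matrix real_of_int A *v x) $ i - (map_matrix real_of_int A *v y) $ i \<in> \<int>"
proof -
  have "(map_matrix real_of_int A *v x) $ i - (map_matrix real_of_int A *v y) $ i
      = (\<Sum>j\<in>UNIV. real_of_int (A $ i $ j) * (x $ j - y $ j))"
    by (simp add: matrix_vector_mult_def sum_subtractf right_diff_distrib)
  also have "\<dots> \<in> \<int>"
    using assms by (intro Ints_sum Ints_mult) auto
  finally show ?thesis .
qed

lift_definition torus_map :: "int ^ 'n ^ 'n \<Rightarrow> 'n torus \<Rightarrow> 'n torus"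
  is "\<lambda>A x. map_matrix real_of_int A *v x"
  by (blast intro: Ints_matrix_vector_mult)

lemma continuous_torus_map: "continuous_on UNIV (torus_map A)"
proof -
  have "open (torus_map A -` U)" if "open U" for U
  proof -
    have "proj_torus -` (torus_map A -` U)
        = (\<lambda>x. map_matrix real_of_int A *v x) -` (proj_torus -` U)"
      by (auto simp: torus_map.abs_eq)
    moreover have "open \<dots>"
      using that unfolding open_torus_def
      by (rule open_vimage) (rule matrix_vector_mult_linear_continuous_on)
    ultimately show ?thesis
      by (simp add: open_torus_def)
  qed
  then show ?thesis
    by (simp add: continuous_on_open_vimage[OF open_UNIV])
qed

lemma measurable_torus_map [measurable]: "torus_map A \<in> borel \<rightarrow>\<^sub>M borel"
  by (intro borel_measurable_continuous_onI continuous_torus_map)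

definition lebesgue_torus :: "'n::finite torus measure" where
  "lebesgue_torus = distr (uniform_measure lborel (cbox 0 1 :: (real ^ 'n) set)) borel proj_torus"

lemma prob_space_lebesgue_torus: "prob_space (lebesgue_torus :: 'n::finite torus measure)"
proof -
  have "measure lborel (cbox 0 1 :: (real ^ 'n) set) = 1"
    by (subst content_cbox_cart) (auto simp: interval_ne_empty_cart)
  then have "emeasure lborel (cbox 0 1 :: (real ^ 'n) set) = 1"
    using emeasure_lborel_cbox_finite[of 0 "1 :: real ^ 'n"]
    by (metis emeasure_eq_ennreal_measure ennreal_1 infinity_ennreal_def order_less_irrefl)
  then interpret prob_space "uniform_measure lborel (cbox 0 1 :: (real ^ 'n) set)"
    by (intro prob_space_uniform_measure) auto
  show ?thesis
    unfolding lebesgue_torus_def by (rule prob_space_distr) simp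
qed

text \<open>The instance \<^class>\<open>power\<close> on vectors, and hence on matrices, is componentwise, so powers for
  the matrix product need their own definition.\<close>

definition matrix_power :: "'a::semiring_1 ^ 'n ^ 'n \<Rightarrow> nat \<Rightarrow> 'a ^ 'n ^ 'n" where
  "matrix_power A j = (((**) A) ^^ j) (mat 1)"

definition borel_probability :: "'a::topological_space measure \<Rightarrow> bool" where
  "borel_probability M \<longleftrightarrow> prob_space M \<and> sets M = sets borel"

definition non_atomic :: "'a measure \<Rightarrow> bool" where
  "non_atomic M \<longleftrightarrow> (\<forall>x\<in>space M. measure M {x} = 0)"

definition invariant_measure :: "('a \<Rightarrow> 'a) \<Rightarrow> 'a measure \<Rightarrow> bool" where
  "invariant_measure T M \<longleftrightarrow>
    T \<in> M \<rightarrow>\<^sub>M M \<and> (\<forall>E\<in>sets M. measure M (T -` E \<inter> space M) = measure M E)"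

definition ergodic_measure :: "('a \<Rightarrow> 'a) \<Rightarrow> 'a measure \<Rightarrow> bool" where
  "ergodic_measure T M \<longleftrightarrow> invariant_measure T M \<and>
    (\<forall>E\<in>sets M. T -` E \<inter> space M = E \<longrightarrow> measure M E \<in> {0, 1})"

text \<open>For a measure on the Borel sets of a second-countable space such as the torus, the product
  \<open>\<sigma>\<close>-algebra carried by \<open>M \<Otimes>\<^sub>M M\<close> is the Borel \<open>\<sigma>\<close>-algebra of the product space.\<close>

definition weakly_mixing :: "('a \<Rightarrow> 'a) \<Rightarrow> 'a measure \<Rightarrow> bool" where
  "weakly_mixing T M \<longleftrightarrow> invariant_measure T M \<and> ergodic_measure (map_prod T T) (M \<Otimes>\<^sub>M M)"

definition strongly_mixing :: "('a \<Rightarrow> 'a) \<Rightarrow> 'a measure \<Rightarrow> bool" where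
  "strongly_mixing T M \<longleftrightarrow> invariant_measure T M \<and>
    (\<forall>E\<in>sets M. \<forall>F\<in>sets M.
      (\<lambda>j. measure M (((T ^^ j) -` E \<inter> space M) \<inter> F)) \<longlonglongrightarrow> measure M E * measure M F)"

text \<open>Injectivity makes this independence of the \<^emph>\<open>family\<close> of vectors \<open>k B\<^sub>i\<close>, not merely of the set
  of its members. The index type \<open>'n\<close> provides exactly as many matrices as their size.\<close>

definition strongly_independent :: "('n \<Rightarrow> int ^ 'n ^ 'n) \<Rightarrow> bool" where
  "strongly_independent B \<longleftrightarrow>
    (\<forall>k :: int ^ 'n. k \<noteq> 0 \<longrightarrow>
      (let v = (\<lambda>i. (\<chi> j. real_of_int ((k v* B i) $ j)) :: real ^ 'n)
       in inj v \<and> independent (range v)))"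

definition folner_sequence :: "(nat \<Rightarrow> nat set) \<Rightarrow> bool" where
  "folner_sequence F \<longleftrightarrow>
    (\<forall>m. finite (F m) \<and> F m \<noteq> {}) \<and>
    (\<forall>r. (\<lambda>m. real (card (sym_diff ((\<lambda>x. x + r) ` F m) (F m))) / real (card (F m)))
           \<longlonglongrightarrow> 0)"

definition has_density :: "(nat \<Rightarrow> nat set) \<Rightarrow> nat set \<Rightarrow> real \<Rightarrow> bool" where
  "has_density F E d \<longleftrightarrow> (\<lambda>m. real (card (E \<inter> F m)) / real (card (F m))) \<longlonglongrightarrow> d"

definition upper_density :: "(nat \<Rightarrow> nat set) \<Rightarrow> nat set \<Rightarrow> ereal" where
  "upper_density F E = limsup (\<lambda>m. ereal (real (card (E \<inter> F m)) / real (card (F m))))"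

definition shift_invariant ::
    "int ^ 'n ^ 'n \<Rightarrow> ('n \<Rightarrow> int ^ 'n ^ 'n) \<Rightarrow> nat set \<Rightarrow> 'n torus measure \<Rightarrow> bool" where
  "shift_invariant A B E M \<longleftrightarrow>
    (\<forall>j\<in>E. \<forall>i. invariant_measure (torus_map (matrix_power A j + B i)) M)"

definition ergodic_condition :: "int ^ 'n ^ 'n \<Rightarrow> 'n torus measure \<Rightarrow> bool" where
  "ergodic_condition A M \<longleftrightarrow> ergodic_measure (torus_map A) M \<and>
    (\<exists>B F E. (\<forall>i. invertible (B i)) \<and> strongly_independent B \<and>
      folner_sequence F \<and> has_density F E 1 \<and> shift_invariant A B E M)"

definition weakly_mixing_condition :: "int ^ 'n ^ 'n \<Rightarrow> 'n torus measure \<Rightarrow> bool" where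
  "weakly_mixing_condition A M \<longleftrightarrow> weakly_mixing (torus_map A) M \<and>
    (\<exists>B F E. (\<forall>i. invertible (B i)) \<and> strongly_independent B \<and>
      folner_sequence F \<and> upper_density F E > 0 \<and> shift_invariant A B E M)"

definition strongly_mixing_condition :: "int ^ 'n ^ 'n \<Rightarrow> 'n torus measure \<Rightarrow> bool" where
  "strongly_mixing_condition A M \<longleftrightarrow> strongly_mixing (torus_map A) M \<and>
    (\<exists>B E. (\<forall>i. invertible (B i)) \<and> strongly_independent B \<and>
      infinite E \<and> shift_invariant A B E M)"

end

theory Submission
  imports Defs
begin

text \<open>Write \<open>m k\<close> for the \<open>k\<close>-th Fourier coefficient of \<open>\<mu>\<close>. Invariance under \<open>A\<^sup>j + B\<^sub>i\<close> means that the
  correlation at time \<open>j\<close> of the characters with indices \<open>k\<close> and \<open>k B\<^sub>i\<close> is \<open>m k - m k * m (k B\<^sub>i)\<close>, the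
  same for every \<open>j \<in> E\<close>. Ergodicity, through the mean ergodic theorem along Foelner sequences, and the
  mixing hypotheses force a correlation that is constant on \<open>E\<close> to vanish; for weak mixing, the mean
  ergodic theorem for \<open>T \<times> T\<close> controls the averages of squared correlations. Hence, if
  \<open>m k \<noteq> 0\<close>, then \<open>m (k B\<^sub>i) = 1\<close> for all \<open>i\<close>, so the characters with indices \<open>k B\<^sub>i\<close> equal \<open>1\<close>
  almost everywhere. By strong independence these equations have only countably many solutions, so \<open>\<mu>\<close>
  has an atom. Otherwise all nontrivial coefficients vanish and \<open>\<mu>\<close> is the Lebesgue measure. An atom of a
  mixing measure has full mass, since the correlations of \<open>{x}\<close> with itself take only two values, both
  nonzero when \<open>0 < \<mu> {x} < 1\<close>.\<close>

subsection \<open>The mean ergodic theorem along Foelner sequences\<close>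

text \<open>The space stays abstract because the mean ergodic theorem is applied to \<open>T\<close>
  on \<open>M\<close> and, for weak mixing, to \<open>map_prod T T\<close> on the product. The
  locale also serves the torus maps of the matrices \<open>matrix_power A j + C\<close>.\<close>

locale measure_preserving = prob_space M for M :: "'a measure" +
  fixes T :: "'a \<Rightarrow> 'a"
  assumes invariant: "invariant_measure T M"
begin

lemma measurable_T [measurable]: "T \<in> M \<rightarrow>\<^sub>M M"
  using invariant by (simp add: invariant_measure_def)

lemma measurable_T_funpow [measurable]: "(T ^^ j) \<in> M \<rightarrow>\<^sub>M M"
  by (rule measurable_compose_n) measurable

lemma distr_T: "distr M M T = M"
proof (rule measure_eqI)
  fix E assume "E \<in> sets (distr M M T)"
  then show "emeasure (distr M M T) E = emeasure M E"
    using invariant by (simp add: emeasure_distr emeasure_eq_measure invariant_measure_def)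
qed simp

lemma distr_T_funpow: "distr M M (T ^^ j) = M"
proof (induction j)
  case (Suc j)
  have "distr M M (T ^^ Suc j) = distr (distr M M (T ^^ j)) M T"
    by (subst distr_distr) (auto simp: comp_def)
  then show ?case by (simp only: Suc distr_T)
qed (simp add: id_def distr_id)

lemma integral_T_funpow:
  fixes f :: "'a \<Rightarrow> 'b::{banach, second_countable_topology}"
  assumes "f \<in> borel_measurable M"
  shows "(\<integral>x. f ((T ^^ j) x) \<partial>M) = (\<integral>x. f x \<partial>M)"
  using integral_distr[of "T ^^ j" M M f] assms by (simp add: distr_T_funpow)

lemma AE_T_funpow:
  assumes "AE x in M. P x"
  shows "AE x in M. P ((T ^^ j) x)"
  by (rule AE_distrD[OF measurable_T_funpow]) (simp only: distr_T_funpow assms)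

lemma integrable_bounded:
  fixes f :: "'a \<Rightarrow> 'b::{banach, second_countable_topology}"
  assumes "f \<in> borel_measurable M" "\<And>x. norm (f x) \<le> K"
  shows "integrable M f"
  using assms by (intro integrable_const_bound[where B = K]) auto

text \<open>The variance of \<open>|f|\<close> is nonnegative; the bound \<open>K\<close> supplies
  integrability of \<open>|f|\<close> and of its square.\<close>

lemma expectation_abs_le_sqrt:
  fixes f :: "'a \<Rightarrow> real"
  assumes "f \<in> borel_measurable M" "\<And>x. \<bar>f x\<bar> \<le> K"
  shows "(\<integral>x. \<bar>f x\<bar> \<partial>M) \<le> sqrt (\<integral>x. (f x)\<^sup>2 \<partial>M)"
proof -
  have "(f x)\<^sup>2 \<le> K\<^sup>2" for x
    using power_mono[OF assms(2)[of x], of 2] by simp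
  then have i: "integrable M (\<lambda>x. \<bar>f x\<bar>)" "integrable M (\<lambda>x. \<bar>f x\<bar>\<^sup>2)"
    using assms integrable_bounded[of "\<lambda>x. \<bar>f x\<bar>" K]
      integrable_bounded[of "\<lambda>x. \<bar>f x\<bar>\<^sup>2" "K\<^sup>2"] by auto
  have "0 \<le> variance (\<lambda>x. \<bar>f x\<bar>)" by (rule variance_positive)
  then show ?thesis
    using variance_eq[OF i] by (simp add: real_le_rsqrt)
qed

text \<open>Ergodicity is defined with exactly invariant sets; the upper limit along orbits turns an almost
  everywhere invariant function into an exactly invariant one.\<close>

lemma ergodic_AE_nonpos:
  fixes h :: "'a \<Rightarrow> real"
  assumes erg: "ergodic_measure T M" and h [measurable]: "integrable M h"
    and inv: "AE x in M. h (T x) = h x" and int: "(\<integral>x. h x \<partial>M) = 0"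
  shows "AE x in M. h x \<le> 0"
proof -
  define h' where "h' x = limsup (\<lambda>n. ereal (h ((T ^^ n) x)))" for x
  have [measurable]: "h' \<in> borel_measurable M"
    unfolding h'_def by measurable
  have h'_T: "h' (T x) = h' x" for x
  proof -
    have "h' (T x) = limsup (\<lambda>n. ereal (h ((T ^^ Suc n) x)))"
      unfolding h'_def by (simp add: funpow_swap1)
    also have "\<dots> = h' x"
      unfolding h'_def using limsup_shift[of "\<lambda>n. ereal (h ((T ^^ n) x))"] by simp
    finally show ?thesis .
  qed
  have "AE x in M. \<forall>n. h ((T ^^ Suc n) x) = h ((T ^^ n) x)"
    using AE_T_funpow[OF inv] by (simp add: AE_all_countable)
  then have eq: "AE x in M. h' x = ereal (h x)"
  proof eventually_elim
    fix x assume *: "\<forall>n. h ((T ^^ Suc n) x) = h ((T ^^ n) x)"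
    have "h ((T ^^ n) x) = h x" for n
      by (induction n) (use * in auto)
    then show "h' x = ereal (h x)" by (simp add: h'_def Limsup_const)
  qed
  define E where "E = {x \<in> space M. h' x > 0}"
  have [measurable]: "E \<in> sets M" unfolding E_def by measurable
  have "T -` E \<inter> space M = E"
    using measurable_space[OF measurable_T] by (auto simp: E_def h'_T)
  then have "measure M E \<in> {0, 1}"
    using erg by (auto simp: ergodic_measure_def)
  moreover have "measure M E \<noteq> 1"
  proof
    assume "measure M E = 1"
    then have "AE x in M. x \<in> E" by (simp add: prob_eq_1)
    with eq have pos: "AE x in M. h x > 0" by eventually_elim (simp add: E_def)
    then have "AE x in M. h x \<ge> 0" by eventually_elim simp
    with h int have "AE x in M. h x = 0" by (simp add: integral_nonneg_eq_0_iff_AE)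
    with pos have "AE x in M. False" by eventually_elim simp
    then show False by simp
  qed
  ultimately have "AE x in M. x \<notin> E"
    by (simp add: prob_eq_0)
  with eq AE_space show ?thesis by eventually_elim (auto simp: E_def)
qed

lemma ergodic_AE_zero:
  fixes h :: "'a \<Rightarrow> real"
  assumes "ergodic_measure T M" "integrable M h" "AE x in M. h (T x) = h x" "(\<integral>x. h x \<partial>M) = 0"
  shows "AE x in M. h x = 0"
  using ergodic_AE_nonpos[OF assms] ergodic_AE_nonpos[of "\<lambda>x. - h x"] assms
  by (auto elim: eventually_elim2)

text \<open>Up to dyadic weights this is the convex hull of the orbit of \<open>f\<close> under
  composition with \<open>T\<close>. Midpoints are what the parallelogram law asks for, and
  induction carries linear facts from \<open>f\<close> to every mean.\<close>

inductive orbit_mean :: "('a \<Rightarrow> real) \<Rightarrow> ('a \<Rightarrow> real) \<Rightarrow> bool" for f where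
  orbit_mean_base: "orbit_mean f f"
| orbit_mean_shift: "orbit_mean f u \<Longrightarrow> orbit_mean f (\<lambda>x. u (T x))"
| orbit_mean_midpoint: "orbit_mean f u \<Longrightarrow> orbit_mean f v \<Longrightarrow> orbit_mean f (\<lambda>x. (u x + v x) / 2)"

lemma orbit_mean_bounded:
  assumes "orbit_mean f u" "f \<in> borel_measurable M" "\<And>x. \<bar>f x\<bar> \<le> K"
  shows "u \<in> borel_measurable M \<and> (\<forall>x. \<bar>u x\<bar> \<le> K) \<and> (\<integral>x. u x \<partial>M) = (\<integral>x. f x \<partial>M)"
  using assms(1)
proof induction
  case orbit_mean_base
  then show ?case using assms by auto
next
  case (orbit_mean_shift u)
  then show ?case using integral_T_funpow[of u 1] by auto
next
  case (orbit_mean_midpoint u v)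
  have "integrable M u" "integrable M v"
    using orbit_mean_midpoint by (auto intro!: integrable_bounded[where K = K])
  moreover have "\<bar>(u x + v x) / 2\<bar> \<le> K" for x
    using orbit_mean_midpoint.IH[THEN conjunct2, THEN conjunct1, THEN spec, of x]
      abs_triangle_ineq[of "u x" "v x"] by simp
  ultimately show ?case using orbit_mean_midpoint.IH by auto
qed

text \<open>F. Riesz: a minimizing sequence for the \<open>L\<^sup>2\<close> norm in the convex hull of the orbit of \<open>f\<close> is
  Cauchy by the parallelogram law. Its shift is also minimizing, so the limit is invariant.\<close>

lemma orbit_mean_small:
  assumes erg: "ergodic_measure T M" and f: "f \<in> borel_measurable M" "\<And>x. \<bar>f x\<bar> \<le> K"
    and int: "(\<integral>x. f x \<partial>M) = 0" and "\<epsilon> > 0"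
  shows "\<exists>u. orbit_mean f u \<and> (\<integral>x. (u x)\<^sup>2 \<partial>M) < \<epsilon>"
proof -
  define N where "N u = (\<integral>x. (u x)\<^sup>2 \<partial>M)" for u :: "'a \<Rightarrow> real"
  define a where "a = Inf (N ` Collect (orbit_mean f))"
  have meas: "u \<in> borel_measurable M" and bd: "\<bar>u x\<bar> \<le> K" and int0: "(\<integral>x. u x \<partial>M) = 0"
    if "orbit_mean f u" for u x
    using orbit_mean_bounded[OF that f] int by auto
  have N_nonneg: "N u \<ge> 0" for u by (simp add: N_def)
  have bdd: "bdd_below (N ` Collect (orbit_mean f))"
    by (rule bdd_belowI[of _ 0]) (auto simp: N_nonneg)
  have sq_bd: "(u x)\<^sup>2 \<le> K\<^sup>2" if "orbit_mean f u" for u x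
    using bd[OF that, of x] by (metis abs_ge_zero power2_abs power_mono)
  \<comment> \<open>The midpoint of \<open>u\<close> and \<open>v\<close> is again an orbit mean, so
    its squared norm is at least the infimum \<open>a\<close>. By the parallelogram law two nearly
    minimal means are therefore close.\<close>
  have par: "(\<integral>x. (u x - v x)\<^sup>2 \<partial>M) \<le> 2 * (N u - a) + 2 * (N v - a)"
    if u: "orbit_mean f u" and v: "orbit_mean f v" for u v
  proof -
    note w = orbit_mean_midpoint[OF u v]
    have [measurable]: "u \<in> borel_measurable M" "v \<in> borel_measurable M" using u v meas by auto
    have i: "integrable M (\<lambda>x. (u x)\<^sup>2)" "integrable M (\<lambda>x. (v x)\<^sup>2)"
      "integrable M (\<lambda>x. ((u x + v x) / 2)\<^sup>2)"
      using sq_bd[OF u] sq_bd[OF v] sq_bd[OF w]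
      by (auto intro!: integrable_bounded[where K = "K\<^sup>2"])
    have "(u x - v x)\<^sup>2 = 2 * (u x)\<^sup>2 + 2 * (v x)\<^sup>2 - 4 * ((u x + v x) / 2)\<^sup>2" for x
      by (simp add: power2_eq_square field_simps)
    then have "(\<integral>x. (u x - v x)\<^sup>2 \<partial>M) = 2 * N u + 2 * N v - 4 * N (\<lambda>x. (u x + v x) / 2)"
      using i by (simp add: N_def)
    moreover have "a \<le> N (\<lambda>x. (u x + v x) / 2)"
      unfolding a_def using w bdd by (intro cInf_lower) auto
    ultimately show ?thesis by simp
  qed
  \<comment> \<open>With the rate \<open>(1/16) ^ m\<close>, \<open>par\<close> bounds the squared
    distance of consecutive terms by \<open>4 * (1/16) ^ m\<close>. Its root
    \<open>2 * (1/4) ^ m\<close> is summable, so the sequence itself converges almost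
    everywhere.\<close>
  have "\<exists>u. orbit_mean f u \<and> N u < a + (1/16) ^ m" for m
  proof -
    have "\<exists>y \<in> N ` Collect (orbit_mean f). y < a + (1/16) ^ m"
      using orbit_mean_base[of f] unfolding a_def by (intro cInf_lessD) auto
    then show ?thesis by auto
  qed
  then obtain u where u: "\<And>m. orbit_mean f (u m)" and Nu: "\<And>m. N (u m) < a + (1/16) ^ m"
    by metis
  have [measurable]: "u m \<in> borel_measurable M" for m using u meas by auto
  have d_int: "(\<integral>x. \<bar>u (Suc m) x - u m x\<bar> \<partial>M) \<le> 2 * (1/4) ^ m" for m
  proof -
    have "(\<integral>x. \<bar>u (Suc m) x - u m x\<bar> \<partial>M) \<le> sqrt (\<integral>x. (u (Suc m) x - u m x)\<^sup>2 \<partial>M)"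
      using bd[OF u[of "Suc m"]] bd[OF u[of m]]
      by (intro expectation_abs_le_sqrt[where K = "2 * K"]) (auto simp: abs_le_iff, smt+)
    also have "\<dots> \<le> sqrt ((2 * (1/4) ^ m)\<^sup>2)"
    proof (rule real_sqrt_le_mono)
      have "(2 * (1/4) ^ m :: real)\<^sup>2 = 4 * (1/16) ^ m"
        by (simp add: power_mult_distrib power2_eq_square flip: power_mult_distrib)
      moreover have "(1/16) ^ Suc m \<le> ((1/16) ^ m :: real)" by simp
      ultimately show "(\<integral>x. (u (Suc m) x - u m x)\<^sup>2 \<partial>M) \<le> (2 * (1/4) ^ m)\<^sup>2"
        using par[OF u[of "Suc m"] u[of m]] Nu[of m] Nu[of "Suc m"] by (smt (verit))
    qed
    also have "\<dots> = 2 * (1/4) ^ m" by (rule real_sqrt_unique) simp_all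
    finally show ?thesis .
  qed
  have "AE x in M. summable (\<lambda>m. \<bar>u (Suc m) x - u m x\<bar>)"
  proof -
    have "(\<integral>\<^sup>+x. (\<Sum>m. ennreal \<bar>u (Suc m) x - u m x\<bar>) \<partial>M)
        = (\<Sum>m. (\<integral>\<^sup>+x. ennreal \<bar>u (Suc m) x - u m x\<bar> \<partial>M))"
      by (rule nn_integral_suminf) auto
    also have "\<dots> \<le> (\<Sum>m. ennreal (2 * (1/4) ^ m))"
    proof (intro suminf_le)
      fix m
      have "integrable M (\<lambda>x. \<bar>u (Suc m) x - u m x\<bar>)"
        using meas[OF u] bd[OF u]
        by (intro integrable_abs Bochner_Integration.integrable_diff integrable_bounded[where K = K]) auto
      then show "(\<integral>\<^sup>+x. ennreal \<bar>u (Suc m) x - u m x\<bar> \<partial>M) \<le> ennreal (2 * (1/4) ^ m)"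
        using d_int[of m] by (subst nn_integral_eq_integral) auto
    qed auto
    also have "\<dots> = ennreal (\<Sum>m. 2 * (1/4) ^ m)"
      by (rule suminf_ennreal2) (auto intro!: summable_mult summable_geometric)
    also have "\<dots> < \<infinity>" by simp
    finally have "AE x in M. (\<Sum>m. ennreal \<bar>u (Suc m) x - u m x\<bar>) \<noteq> \<infinity>"
      by (intro nn_integral_PInf_AE) auto
    then show ?thesis
      by eventually_elim (auto intro: summable_suminf_not_top)
  qed
  then have conv: "AE x in M. (\<lambda>m. u m x) \<longlonglongrightarrow> lim (\<lambda>m. u m x)"
  proof eventually_elim
    case (elim x)
    then have "summable (\<lambda>m. u (Suc m) x - u m x)"
      by (rule summable_rabs_cancel)
    then have "convergent (\<lambda>n. \<Sum>m<n. u (Suc m) x - u m x)"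
      by (simp add: summable_iff_convergent)
    then have "convergent (\<lambda>n. u n x - u 0 x)" by (simp add: sum_lessThan_telescope[of "\<lambda>n. u n x"])
    then have "convergent (\<lambda>n. u n x)" by (simp add: convergent_diff_const_right_iff)
    then show ?case by (simp add: convergent_LIMSEQ_iff)
  qed
  \<comment> \<open>Where the sequence diverges, \<open>lim\<close> is an unspecified value.
    Clamping to \<open>[-K, K]\<close> makes \<open>h\<close> bounded everywhere and changes nothing
    at points of convergence.\<close>
  define h where "h x = max (- K) (min K (lim (\<lambda>m. u m x)))" for x
  have [measurable]: "h \<in> borel_measurable M" unfolding h_def by measurable
  have K0: "K \<ge> 0" using f(2)[of undefined] by linarith
  have h_bd: "\<bar>h x\<bar> \<le> K" for x using K0 by (auto simp: h_def)
  have conv: "AE x in M. (\<lambda>m. u m x) \<longlonglongrightarrow> h x"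
    using conv
  proof eventually_elim
    case (elim x)
    have "(\<lambda>m. max (- K) (min K (u m x))) \<longlonglongrightarrow> h x"
      unfolding h_def using elim by (intro tendsto_max tendsto_min tendsto_const)
    moreover have "max (- K) (min K (u m x)) = u m x" for m
      using bd[OF u[of m], of x] by linarith
    ultimately show ?case by simp
  qed
  have "(\<lambda>m. \<integral>x. u m x \<partial>M) \<longlonglongrightarrow> (\<integral>x. h x \<partial>M)"
    using conv bd[OF u] by (intro integral_dominated_convergence[where w = "\<lambda>_. K"]) auto
  then have h_int: "(\<integral>x. h x \<partial>M) = 0"
    by (simp add: int0[OF u] LIMSEQ_const_iff)
  have "(\<lambda>m. \<integral>x. (u m x)\<^sup>2 \<partial>M) \<longlonglongrightarrow> (\<integral>x. (h x)\<^sup>2 \<partial>M)"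
    using conv sq_bd[OF u]
    by (intro integral_dominated_convergence[where w = "\<lambda>_. K\<^sup>2"])
      (auto elim!: eventually_mono intro: tendsto_power)
  then have lim_N: "(\<lambda>m. N (u m)) \<longlonglongrightarrow> N h" by (simp add: N_def)
  have "AE x in M. h (T x) = h x"
  proof -
    have NT: "N (\<lambda>x. v (T x)) = N v" if "v \<in> borel_measurable M" for v
      using integral_T_funpow[of "\<lambda>x. (v x)\<^sup>2" 1] that by (simp add: N_def)
    have le: "(\<integral>x. (u m x - u m (T x))\<^sup>2 \<partial>M) \<le> 4 * (1/16) ^ m" for m
      using par[OF u[of m] orbit_mean_shift[OF u[of m]]] Nu[of m] NT[of "u m"] by simp
    have "(\<lambda>m. 4 * (1/16) ^ m :: real) \<longlonglongrightarrow> 4 * 0"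
      by (intro tendsto_mult tendsto_const LIMSEQ_power_zero) auto
    then have lim0: "(\<lambda>m. 4 * (1/16) ^ m :: real) \<longlonglongrightarrow> 0" by simp
    have 1: "(\<lambda>m. \<integral>x. (u m x - u m (T x))\<^sup>2 \<partial>M) \<longlonglongrightarrow> 0"
      by (rule tendsto_sandwich[OF _ _ tendsto_const lim0]) (use le in auto)
    have convT: "AE x in M. (\<lambda>m. u m (T x)) \<longlonglongrightarrow> h (T x)"
      using AE_T_funpow[OF conv, of 1] by simp
    have "(u m x - u m (T x))\<^sup>2 \<le> (2 * K)\<^sup>2" for m x
      using bd[OF u[of m], of x] bd[OF u[of m], of "T x"] K0
      by (subst abs_le_square_iff[symmetric]) linarith
    moreover have "AE x in M. (\<lambda>m. (u m x - u m (T x))\<^sup>2) \<longlonglongrightarrow> (h x - h (T x))\<^sup>2"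
      using conv convT by eventually_elim (intro tendsto_power tendsto_diff)
    ultimately have "(\<lambda>m. \<integral>x. (u m x - u m (T x))\<^sup>2 \<partial>M) \<longlonglongrightarrow> (\<integral>x. (h x - h (T x))\<^sup>2 \<partial>M)"
      by (intro integral_dominated_convergence[where w = "\<lambda>_. (2 * K)\<^sup>2"]) auto
    with 1 have 2: "(\<integral>x. (h x - h (T x))\<^sup>2 \<partial>M) = 0" by (rule LIMSEQ_unique[symmetric])
    have "(h x - h (T x))\<^sup>2 \<le> (2 * K)\<^sup>2" for x
      using h_bd[of x] h_bd[of "T x"] K0
      by (subst abs_le_square_iff[symmetric]) linarith
    then have "integrable M (\<lambda>x. (h x - h (T x))\<^sup>2)"
      by (intro integrable_bounded[where K = "(2 * K)\<^sup>2"]) auto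
    with 2 have "AE x in M. (h x - h (T x))\<^sup>2 = 0"
      by (simp add: integral_nonneg_eq_0_iff_AE)
    then show ?thesis by eventually_elim simp
  qed
  \<comment> \<open>The limit is invariant with mean zero, so ergodicity makes it vanish; hence the
    squared norms of the minimizing sequence tend to 0.\<close>
  then have "AE x in M. h x = 0"
    using h_bd h_int by (intro ergodic_AE_zero[OF erg] integrable_bounded[where K = K]) auto
  then have "N h = (\<integral>x. 0 \<partial>M)"
    unfolding N_def by (intro integral_cong_AE) auto
  with lim_N have "eventually (\<lambda>m. N (u m) < \<epsilon>) sequentially"
    using \<open>\<epsilon> > 0\<close> by (intro order_tendstoD(2)) auto
  then show ?thesis
    using u by (auto simp: N_def dest!: eventually_happens'[OF sequentially_bot])
qed

end

section \<open>Averages over finite sets of times\<close>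

definition average :: "nat set \<Rightarrow> (nat \<Rightarrow> real) \<Rightarrow> real" where
  "average S c = (\<Sum>j\<in>S. c j) / real (card S)"

lemma average_add: "average S (\<lambda>j. c j + d j) = average S c + average S d"
  by (simp add: average_def sum.distrib add_divide_distrib)

lemma average_diff: "average S (\<lambda>j. c j - d j) = average S c - average S d"
  by (simp add: average_def sum_subtractf diff_divide_distrib)

lemma average_cmult: "average S (\<lambda>j. r * c j) = r * average S c"
  by (simp add: average_def sum_distrib_left)

lemma average_mono: "(\<And>j. j \<in> S \<Longrightarrow> c j \<le> d j) \<Longrightarrow> average S c \<le> average S d"
  unfolding average_def by (intro divide_right_mono sum_mono) auto

lemma average_const: "finite S \<Longrightarrow> S \<noteq> {} \<Longrightarrow> average S (\<lambda>_. r) = r"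
  by (simp add: average_def)

lemma average_indicator: "finite S \<Longrightarrow> average S (indicator E) = real (card (E \<inter> S)) / real (card S)"
  by (simp add: average_def indicator_def of_bool_def Int_commute flip: sum.inter_restrict)

lemma abs_average_le:
  assumes "finite S" "S \<noteq> {}" "\<And>j. \<bar>c j\<bar> \<le> r"
  shows "\<bar>average S c\<bar> \<le> r"
proof -
  have "average S c \<le> average S (\<lambda>_. r)" "average S (\<lambda>_. - r) \<le> average S c"
    using assms(3) by (auto intro!: average_mono simp: abs_le_iff minus_le_iff)
  then show ?thesis using assms(1,2) by (simp add: average_const)
qed

text \<open>Reindexing turns the shifted sum into a sum over \<open>F m + 1\<close>. The two sums
  differ only on the symmetric difference of \<open>F m + 1\<close> and \<open>F m\<close>, whose
  share of \<open>F m\<close> vanishes by the Foelner property with \<open>r = 1\<close>.\<close>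

lemma folner_average_shift:
  assumes F: "folner_sequence F" and c: "\<And>j. \<bar>c j\<bar> \<le> K"
  shows "(\<lambda>m. average (F m) (\<lambda>j. c (Suc j) - c j)) \<longlonglongrightarrow> 0"
proof -
  define D where "D m = sym_diff ((\<lambda>x. x + 1) ` F m) (F m)" for m
  have fin: "finite (F m)" for m using F by (simp add: folner_sequence_def)
  have bound: "\<bar>average (F m) (\<lambda>j. c (Suc j) - c j)\<bar> \<le> K * (real (card (D m)) / real (card (F m)))" for m
  proof -
    let ?A = "(\<lambda>x. x + 1) ` F m"
    have "(\<Sum>j\<in>F m. c (Suc j)) = sum c ?A"
      by (subst sum.reindex) auto
    also have "sum c ?A - sum c (F m) = sum c (?A - F m) - sum c (F m - ?A)"
      using fin[of m] sum.Int_Diff[of ?A c "F m"] sum.Int_Diff[of "F m" c ?A] by (simp add: Int_commute)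
    also have "\<bar>\<dots>\<bar> \<le> (\<Sum>j\<in>?A - F m. \<bar>c j\<bar>) + (\<Sum>j\<in>F m - ?A. \<bar>c j\<bar>)"
      using sum_abs[of c "?A - F m"] sum_abs[of c "F m - ?A"] by linarith
    also have "\<dots> = (\<Sum>j\<in>D m. \<bar>c j\<bar>)"
      unfolding D_def by (rule sum.union_disjoint[symmetric]) (use fin in auto)
    also have "\<dots> \<le> (\<Sum>j\<in>D m. K)" using c by (intro sum_mono) auto
    finally have "\<bar>(\<Sum>j\<in>F m. c (Suc j)) - sum c (F m)\<bar> \<le> K * real (card (D m))"
      by (simp add: mult.commute)
    then show ?thesis
      by (simp add: average_def sum_subtractf abs_divide divide_right_mono)
  qed
  have "(\<lambda>m. real (card (D m)) / real (card (F m))) \<longlonglongrightarrow> 0"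
    using F unfolding folner_sequence_def D_def by blast
  then have lim: "(\<lambda>m. K * (real (card (D m)) / real (card (F m)))) \<longlonglongrightarrow> 0"
    by (rule tendsto_mult_right_zero)
  show ?thesis
    by (rule tendsto_rabs_zero_cancel, rule tendsto_sandwich[OF _ _ tendsto_const lim])
      (use bound in auto)
qed

section \<open>Averaged correlations of an ergodic map\<close>

context measure_preserving
begin

text \<open>The form is bilinear, without conjugation of \<open>g\<close>, so that two characters
  give an integral of a product of characters. Values in a normed field cover both real functions,
  for which the limit theorems are proved, and complex characters.\<close>

definition correlation :: "('a \<Rightarrow> 'b) \<Rightarrow> ('a \<Rightarrow> 'b) \<Rightarrow> nat \<Rightarrow> 'b::{real_normed_field, banach, second_countable_topology}" where
  "correlation f g j = (\<integral>x. f ((T ^^ j) x) * g x \<partial>M) - (\<integral>x. f x \<partial>M) * (\<integral>x. g x \<partial>M)"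

lemma integrable_correlation:
  fixes f g :: "'a \<Rightarrow> 'b::{real_normed_field, banach, second_countable_topology}"
  assumes [measurable]: "f \<in> borel_measurable M" "g \<in> borel_measurable M"
    and bd: "\<And>x. norm (f x) \<le> K" "\<And>x. norm (g x) \<le> L"
  shows "integrable M (\<lambda>x. f ((T ^^ j) x) * g x)"
proof (rule integrable_bounded)
  show "norm (f ((T ^^ j) x) * g x) \<le> K * L" for x
    using bd norm_ge_zero[of "f x"] order_trans[OF norm_ge_zero bd(1)] unfolding norm_mult by (intro mult_mono) auto
qed simp

text \<open>Centering \<open>f\<close> alone already subtracts the product of the expectations. This
  permits a first factor of mean zero, as \<open>orbit_mean_small\<close> requires.\<close>

lemma correlation_centered:
  fixes f g :: "'a \<Rightarrow> 'b::{real_normed_field, banach, second_countable_topology}"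
  assumes [measurable]: "f \<in> borel_measurable M" "g \<in> borel_measurable M"
    and bd: "\<And>x. norm (f x) \<le> K" "\<And>x. norm (g x) \<le> L"
  shows "(\<integral>x. (f ((T ^^ j) x) - expectation f) * g x \<partial>M) = correlation f g j"
  using integrable_correlation[OF assms, of j] integrable_bounded[OF assms(2) bd(2)]
  by (simp add: correlation_def left_diff_distrib)

text \<open>Replacing the centered function \<open>f0\<close> by one of its orbit means does not
  affect the limit of the averages: a shift costs a Foelner boundary term, and midpoints are handled
  by linearity. An orbit mean of small norm has correlations with \<open>g\<close> that are small
  uniformly in time.\<close>

theorem correlation_average_tendsto_0:
  fixes f g :: "'a \<Rightarrow> real"
  assumes erg: "ergodic_measure T M" and F: "folner_sequence F"
    and [measurable]: "f \<in> borel_measurable M" "g \<in> borel_measurable M"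
    and bd: "\<And>x. \<bar>f x\<bar> \<le> K" "\<And>x. \<bar>g x\<bar> \<le> L"
  shows "(\<lambda>m. average (F m) (correlation f g)) \<longlonglongrightarrow> 0"
proof -
  define f0 where "f0 x = f x - expectation f" for x
  define K0 where "K0 = K + \<bar>expectation f\<bar>"
  have f0: "f0 \<in> borel_measurable M" "\<And>x. \<bar>f0 x\<bar> \<le> K0"
    using bd(1) unfolding f0_def K0_def
    by (auto intro!: order_trans[OF abs_triangle_ineq4] add_right_mono)
  have int0: "expectation f0 = 0"
    using integrable_bounded[of f K] bd by (simp add: f0_def[abs_def] prob_space)
  have fin: "finite (F m)" "F m \<noteq> {}" for m using F by (auto simp: folner_sequence_def)
  have L0: "L \<ge> 0" using bd(2)[of undefined] by linarith
  define I where "I u j = (\<integral>x. u ((T ^^ j) x) * g x \<partial>M)" for u j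
  have I_int: "integrable M (\<lambda>x. u ((T ^^ j) x) * g x)" if "orbit_mean f0 u" for u j
    using orbit_mean_bounded[OF that f0] bd(2) by (intro integrable_correlation[where K = K0 and L = L]) auto
  have I_le: "\<bar>I u j\<bar> \<le> L * sqrt (\<integral>x. (u x)\<^sup>2 \<partial>M)" if u: "orbit_mean f0 u" for u j
  proof -
    have [measurable]: "u \<in> borel_measurable M" and u_bd: "\<And>x. \<bar>u x\<bar> \<le> K0"
      using orbit_mean_bounded[OF u f0] by auto
    have "\<bar>I u j\<bar> \<le> (\<integral>x. \<bar>u ((T ^^ j) x) * g x\<bar> \<partial>M)"
      unfolding I_def by (rule integral_abs_bound)
    also have "\<dots> \<le> (\<integral>x. L * \<bar>u ((T ^^ j) x)\<bar> \<partial>M)"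
    proof (rule integral_mono)
      show "integrable M (\<lambda>x. L * \<bar>u ((T ^^ j) x)\<bar>)"
        using u_bd by (intro integrable_mult_right integrable_bounded[where K = K0]) auto
      show "\<bar>u ((T ^^ j) x) * g x\<bar> \<le> L * \<bar>u ((T ^^ j) x)\<bar>" for x
        using mult_right_mono[OF bd(2)[of x], of "\<bar>u ((T ^^ j) x)\<bar>"] by (simp add: abs_mult mult.commute)
    qed (use I_int[OF u] in simp)
    also have "\<dots> = L * (\<integral>x. \<bar>u x\<bar> \<partial>M)"
      using integral_T_funpow[of "\<lambda>x. \<bar>u x\<bar>" j] by simp
    also have "\<dots> \<le> L * sqrt (\<integral>x. (u x)\<^sup>2 \<partial>M)"
      using L0 u_bd by (intro mult_left_mono expectation_abs_le_sqrt) auto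
    finally show ?thesis .
  qed
  have I_bd: "\<bar>I u j\<bar> \<le> L * K0" if u: "orbit_mean f0 u" for u j
  proof -
    have *: "\<bar>u x\<bar> \<le> K0" for x using orbit_mean_bounded[OF u f0] by auto
    have "\<bar>I u j\<bar> \<le> (\<integral>x. \<bar>u ((T ^^ j) x) * g x\<bar> \<partial>M)"
      unfolding I_def by (rule integral_abs_bound)
    also have "\<dots> \<le> (\<integral>x. L * K0 \<partial>M)"
    proof (rule integral_mono)
      show "\<bar>u ((T ^^ j) x) * g x\<bar> \<le> L * K0" for x
        using mult_mono[OF bd(2)[of x] *[of "(T ^^ j) x"]] L0 by (simp add: abs_mult mult.commute)
    qed (use I_int[OF u] in simp_all)
    finally show ?thesis by (simp add: prob_space)
  qed
  have close: "(\<lambda>m. average (F m) (\<lambda>j. I f0 j - I u j)) \<longlonglongrightarrow> 0" if "orbit_mean f0 u" for u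
    using that
  proof induction
    case orbit_mean_base
    show ?case by (simp add: average_def)
  next
    case (orbit_mean_shift u)
    have "I (\<lambda>x. u (T x)) j = I u (Suc j)" for j
      by (simp add: I_def)
    then have "average (F m) (\<lambda>j. I f0 j - I (\<lambda>x. u (T x)) j)
        = average (F m) (\<lambda>j. I f0 j - I u j) - average (F m) (\<lambda>j. I u (Suc j) - I u j)" for m
      by (simp add: average_diff)
    moreover have "(\<lambda>m. average (F m) (\<lambda>j. I u (Suc j) - I u j)) \<longlonglongrightarrow> 0"
      using I_bd[OF orbit_mean_shift.hyps] by (rule folner_average_shift[OF F])
    ultimately show ?case
      using tendsto_diff[OF orbit_mean_shift.IH] by fastforce
  next
    case (orbit_mean_midpoint u v)
    have "I (\<lambda>x. (u x + v x) / 2) j = (1/2) * (I u j + I v j)" for j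
      using I_int[OF orbit_mean_midpoint.hyps(1), of j] I_int[OF orbit_mean_midpoint.hyps(2), of j]
      by (simp add: I_def add_divide_distrib distrib_right)
    then have "average (F m) (\<lambda>j. I f0 j - I (\<lambda>x. (u x + v x) / 2) j)
        = (1/2) * (average (F m) (\<lambda>j. I f0 j - I u j) + average (F m) (\<lambda>j. I f0 j - I v j))" for m
      by (simp only: average_diff average_add average_cmult) (simp add: field_simps)
    then show ?case
      by (simp only:) (intro tendsto_mult_right_zero tendsto_add_zero orbit_mean_midpoint.IH)
  qed
  have "(\<lambda>m. average (F m) (I f0)) \<longlonglongrightarrow> 0"
  proof (rule LIMSEQ_I)
    fix e :: real assume "e > 0"
    \<comment> \<open>With this \<open>\<delta>\<close>, \<open>I_le\<close> bounds every
      correlation of \<open>u\<close> by \<open>L * (e / (2 * (L + 1)))\<close>, which is at most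
      \<open>e / 2\<close>. The summand 1 keeps the denominator positive when
      \<open>L = 0\<close>.\<close>
    define \<delta> where "\<delta> = (e / (2 * (L + 1)))\<^sup>2"
    have "\<delta> > 0" using \<open>e > 0\<close> L0 by (simp add: \<delta>_def)
    then obtain u where u: "orbit_mean f0 u" and small: "(\<integral>x. (u x)\<^sup>2 \<partial>M) < \<delta>"
      using orbit_mean_small[OF erg f0 int0] by blast
    have "sqrt (\<integral>x. (u x)\<^sup>2 \<partial>M) \<le> e / (2 * (L + 1))"
      using small real_sqrt_le_mono[of "\<integral>x. (u x)\<^sup>2 \<partial>M" \<delta>] \<open>e > 0\<close> L0 by (simp add: \<delta>_def)
    then have "\<bar>I u j\<bar> \<le> L * (e / (2 * (L + 1)))" for j
      using I_le[OF u, of j] mult_left_mono[OF _ L0] by (meson order_trans)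
    then have 1: "\<bar>average (F m) (I u)\<bar> \<le> L * (e / (2 * (L + 1)))" for m
      by (rule abs_average_le[OF fin])
    have 2: "L * (e / (2 * (L + 1))) \<le> e / 2"
      using \<open>e > 0\<close> L0 by (simp add: field_simps)
    obtain n where "\<And>m. m \<ge> n \<Longrightarrow> \<bar>average (F m) (\<lambda>j. I f0 j - I u j)\<bar> < e / 2"
      using LIMSEQ_D[OF close[OF u], of "e / 2"] \<open>e > 0\<close> by auto
    moreover have "average (F m) (I f0) = average (F m) (\<lambda>j. I f0 j - I u j) + average (F m) (I u)" for m
      by (simp add: average_diff)
    ultimately have "\<bar>average (F m) (I f0)\<bar> < e" if "m \<ge> n" for m
      using 1[of m] 2 that by (smt (verit) field_sum_of_halves)
    then show "\<exists>no. \<forall>m\<ge>no. norm (average (F m) (I f0) - 0) < e" by auto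
  qed
  moreover have "I f0 = correlation f g"
    using correlation_centered[of f g K L] bd by (auto simp: I_def f0_def fun_eq_iff)
  ultimately show ?thesis by simp
qed

end

subsection \<open>Correlations of mixing transformations\<close>

text \<open>On \<open>E\<close> the difference \<open>c j - d\<close> is zero, and elsewhere it is
  at most \<open>R + |d|\<close> in absolute value. The times outside \<open>E\<close> have density
  zero, so the averages of \<open>c\<close> tend to \<open>d\<close> as well as to 0.\<close>

lemma density_one_average:
  assumes F: "folner_sequence F" and E: "has_density F E 1"
    and lim: "(\<lambda>m. average (F m) c) \<longlonglongrightarrow> 0"
    and c: "\<And>j. \<bar>c j\<bar> \<le> R" and d: "\<And>j. j \<in> E \<Longrightarrow> c j = d"
  shows "d = 0"
proof -
  have fin: "finite (F m)" "F m \<noteq> {}" for m using F by (auto simp: folner_sequence_def)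
  define \<rho> where "\<rho> m = average (F m) (indicator E)" for m
  have "\<rho> \<longlonglongrightarrow> 1"
    using E by (simp add: \<rho>_def[abs_def] average_indicator fin has_density_def)
  then have "(\<lambda>m. (R + \<bar>d\<bar>) * (1 - \<rho> m)) \<longlonglongrightarrow> (R + \<bar>d\<bar>) * (1 - 1)"
    by (intro tendsto_intros)
  then have z: "(\<lambda>m. (R + \<bar>d\<bar>) * (1 - \<rho> m)) \<longlonglongrightarrow> 0" by simp
  have "\<bar>average (F m) c - d\<bar> \<le> (R + \<bar>d\<bar>) * (1 - \<rho> m)" for m
  proof -
    have le: "\<bar>c j - d\<bar> \<le> (R + \<bar>d\<bar>) * (1 - indicator E j)" for j
      using c[of j] d[of j] by (cases "j \<in> E") auto
    have "average (F m) (\<lambda>j. c j - d) \<le> average (F m) (\<lambda>j. (R + \<bar>d\<bar>) * (1 - indicator E j))"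
      "average (F m) (\<lambda>j. - 1 * ((R + \<bar>d\<bar>) * (1 - indicator E j))) \<le> average (F m) (\<lambda>j. c j - d)"
      using le by (auto intro!: average_mono simp: abs_le_iff minus_le_iff)
    then show ?thesis
      by (simp only: average_diff average_cmult average_const[OF fin] abs_le_iff flip: \<rho>_def) simp
  qed
  then have "(\<lambda>m. average (F m) c - d) \<longlonglongrightarrow> 0"
    by (intro tendsto_rabs_zero_cancel[OF tendsto_sandwich[OF _ _ tendsto_const z]] always_eventually) auto
  then have "(\<lambda>m. average (F m) c) \<longlonglongrightarrow> d" by (simp add: LIM_zero_iff)
  with lim show ?thesis using LIMSEQ_unique by blast
qed

text \<open>If \<open>d\<close> is positive, the indicator of \<open>E\<close> is at most
  \<open>c / d\<close>, because \<open>c\<close> is nonnegative off \<open>E\<close>. Vanishing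
  averages of \<open>c\<close> would then give \<open>E\<close> upper density zero.\<close>

lemma upper_density_average:
  assumes F: "folner_sequence F" and E: "upper_density F E > 0"
    and lim: "(\<lambda>m. average (F m) c) \<longlonglongrightarrow> 0"
    and c: "\<And>j. 0 \<le> c j" and d: "\<And>j. j \<in> E \<Longrightarrow> c j = d"
  shows "d = 0"
proof (rule ccontr)
  assume "d \<noteq> 0"
  have fin: "finite (F m)" "F m \<noteq> {}" for m using F by (auto simp: folner_sequence_def)
  define \<rho> where "\<rho> m = average (F m) (indicator E)" for m
  \<comment> \<open>An element of \<open>E\<close> is what makes \<open>d\<close> a value of
    \<open>c\<close>, and hence nonnegative.\<close>
  have "E \<noteq> {}"
  proof
    assume "E = {}"
    then show False using E by (simp add: upper_density_def Limsup_const zero_ereal_def)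
  qed
  then have "d > 0" using c d \<open>d \<noteq> 0\<close> by (metis all_not_in_conv order_less_le)
  have "\<rho> m \<le> inverse d * average (F m) c" for m
  proof -
    have "average (F m) (indicator E) \<le> average (F m) (\<lambda>j. inverse d * c j)"
      using c d \<open>d > 0\<close> by (intro average_mono) (auto simp: indicator_def)
    then show ?thesis by (simp only: \<rho>_def average_cmult)
  qed
  moreover have "\<rho> m \<ge> 0" for m by (simp add: \<rho>_def average_def sum_nonneg)
  moreover have z: "(\<lambda>m. inverse d * average (F m) c) \<longlonglongrightarrow> 0"
    using lim by (rule tendsto_mult_right_zero)
  ultimately have "\<rho> \<longlonglongrightarrow> 0"
    by (intro tendsto_sandwich[OF _ _ tendsto_const z] always_eventually) auto
  then have "(\<lambda>m. ereal (\<rho> m)) \<longlonglongrightarrow> ereal 0" by (intro tendsto_intros)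
  then have "limsup (\<lambda>m. ereal (\<rho> m)) = ereal 0"
    by (intro lim_imp_Limsup) auto
  with E show False
    by (simp add: upper_density_def \<rho>_def average_indicator fin zero_ereal_def)
qed

context measure_preserving
begin

lemma abs_correlation_le:
  fixes f g :: "'a \<Rightarrow> real"
  assumes [measurable]: "f \<in> borel_measurable M" "g \<in> borel_measurable M"
    and bd: "\<And>x. \<bar>f x\<bar> \<le> K" "\<And>x. \<bar>g x\<bar> \<le> L"
  shows "\<bar>correlation f g j\<bar> \<le> 2 * K * L"
proof -
  have K0: "K \<ge> 0" "L \<ge> 0" using bd[of undefined] by auto
  have abs_int: "\<bar>expectation h\<bar> \<le> B" if [measurable]: "h \<in> borel_measurable M" and "\<And>x. \<bar>h x\<bar> \<le> B" for h :: "'a \<Rightarrow> real" and B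
  proof -
    have "\<bar>expectation h\<bar> \<le> (\<integral>x. \<bar>h x\<bar> \<partial>M)" by (rule integral_abs_bound)
    also have "\<dots> \<le> (\<integral>x. B \<partial>M)"
      using that by (intro integral_mono integrable_abs integrable_bounded[of h B]) auto
    finally show ?thesis by (simp add: prob_space)
  qed
  have "\<bar>\<integral>x. f ((T ^^ j) x) * g x \<partial>M\<bar> \<le> K * L"
    using bd K0 by (intro abs_int) (auto simp: abs_mult intro!: mult_mono)
  moreover have "\<bar>expectation f * expectation g\<bar> \<le> K * L"
    using abs_int[of f K] abs_int[of g L] bd K0 by (auto simp: abs_mult intro!: mult_mono)
  ultimately show ?thesis unfolding correlation_def by linarith
qed

text \<open>A squared correlation is itself a correlation on the product space. By Fubini,
  \<open>f0 (fst w) * f0 (snd w)\<close> has mean zero, and its integral against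
  \<open>g (fst w) * g (snd w)\<close> along \<open>map_prod T T\<close> is the square of the
  original correlation. The ergodic theorem for the product then applies.\<close>

theorem weakly_mixing_average_tendsto_0:
  fixes f g :: "'a \<Rightarrow> real"
  assumes wm: "weakly_mixing T M" and F: "folner_sequence F"
    and [measurable]: "f \<in> borel_measurable M" "g \<in> borel_measurable M"
    and bd: "\<And>x. \<bar>f x\<bar> \<le> K" "\<And>x. \<bar>g x\<bar> \<le> L"
  shows "(\<lambda>m. average (F m) (\<lambda>j. (correlation f g j)\<^sup>2)) \<longlonglongrightarrow> 0"
proof -
  have erg: "ergodic_measure (map_prod T T) (M \<Otimes>\<^sub>M M)"
    using wm by (simp add: weakly_mixing_def)
  interpret pp: pair_prob_space M M ..
  interpret P: measure_preserving "M \<Otimes>\<^sub>M M" "map_prod T T"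
    using erg by unfold_locales (simp add: ergodic_measure_def)
  have power: "(map_prod T T ^^ j) w = ((T ^^ j) (fst w), (T ^^ j) (snd w))" for j w
    by (induction j) auto
  have prod_int: "(\<integral>w. h (fst w) * h (snd w) \<partial>(M \<Otimes>\<^sub>M M)) = (expectation h)\<^sup>2"
    if [measurable]: "h \<in> borel_measurable M" and B: "\<And>x. \<bar>h x\<bar> \<le> B" for h :: "'a \<Rightarrow> real" and B
  proof -
    have "\<bar>h (fst w) * h (snd w)\<bar> \<le> B * B" for w
      using B order_trans[OF abs_ge_zero B] unfolding abs_mult by (intro mult_mono) auto
    then have "integrable (M \<Otimes>\<^sub>M M) (\<lambda>w. h (fst w) * h (snd w))"
      by (intro P.integrable_bounded[where K = "B * B"]) auto
    from pp.integral_fst'[OF this] show ?thesis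
      by (simp add: power2_eq_square)
  qed
  define f0 where "f0 x = f x - expectation f" for x
  define K0 where "K0 = K + \<bar>expectation f\<bar>"
  have [measurable]: "f0 \<in> borel_measurable M" unfolding f0_def by measurable
  have f0_bd: "\<bar>f0 x\<bar> \<le> K0" for x
    using bd(1)[of x] unfolding f0_def K0_def by linarith
  have int0: "expectation f0 = 0"
    using integrable_bounded[of f K] bd by (simp add: f0_def[abs_def] prob_space)
  define f2 where "f2 w = f0 (fst w) * f0 (snd w)" for w
  define g2 where "g2 w = g (fst w) * g (snd w)" for w
  have [measurable]: "f2 \<in> borel_measurable (M \<Otimes>\<^sub>M M)" "g2 \<in> borel_measurable (M \<Otimes>\<^sub>M M)"
    unfolding f2_def g2_def by measurable
  have f2_bd: "\<bar>f2 w\<bar> \<le> K0 * K0" and g2_bd: "\<bar>g2 w\<bar> \<le> L * L" for w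
    unfolding f2_def g2_def abs_mult
    using f0_bd bd(2) order_trans[OF abs_ge_zero f0_bd] order_trans[OF abs_ge_zero bd(2)]
    by (auto intro!: mult_mono)
  have "P.correlation f2 g2 j = (correlation f g j)\<^sup>2" for j
  proof -
    define h where "h x = f0 ((T ^^ j) x) * g x" for x
    have [measurable]: "h \<in> borel_measurable M" unfolding h_def by measurable
    have h_bd: "\<bar>h x\<bar> \<le> K0 * L" for x
      unfolding h_def abs_mult using f0_bd bd(2) order_trans[OF abs_ge_zero f0_bd]
      by (auto intro!: mult_mono)
    have "f2 ((map_prod T T ^^ j) w) * g2 w = h (fst w) * h (snd w)" for w
      by (simp add: f2_def g2_def h_def power mult_ac)
    then have "(\<integral>w. f2 ((map_prod T T ^^ j) w) * g2 w \<partial>(M \<Otimes>\<^sub>M M)) = (expectation h)\<^sup>2"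
      using prod_int[of h "K0 * L"] h_bd by simp
    moreover have "integral\<^sup>L (M \<Otimes>\<^sub>M M) f2 = 0"
      using prod_int[of f0 K0] f0_bd by (simp add: f2_def[abs_def] int0)
    moreover have "expectation h = correlation f g j"
      using correlation_centered[of f g K L j] bd by (simp add: h_def[abs_def] f0_def)
    ultimately show ?thesis by (simp add: P.correlation_def)
  qed
  then have "P.correlation f2 g2 = (\<lambda>j. (correlation f g j)\<^sup>2)" by auto
  then show ?thesis
    using P.correlation_average_tendsto_0[of F f2 g2 "K0 * K0" "L * L"] erg F f2_bd g2_bd by simp
qed

section \<open>Decay of correlations under strong mixing\<close>

lemma integrable_T_funpow:
  fixes f :: "'a \<Rightarrow> real"
  assumes "integrable M f"
  shows "integrable M (\<lambda>x. f ((T ^^ j) x))"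
  by (rule integrable_distr[OF measurable_T_funpow[of j]]) (simp only: distr_T_funpow assms)

lemma integrable_mult_bounded:
  fixes u v :: "'a \<Rightarrow> real"
  assumes "integrable M u" and [measurable]: "v \<in> borel_measurable M" and bd: "\<And>x. \<bar>v x\<bar> \<le> L"
  shows "integrable M (\<lambda>x. u x * v x)" and "\<bar>\<integral>x. u x * v x \<partial>M\<bar> \<le> L * (\<integral>x. \<bar>u x\<bar> \<partial>M)"
proof -
  have [measurable]: "u \<in> borel_measurable M" using assms by auto
  have le: "\<bar>u x * v x\<bar> \<le> L * \<bar>u x\<bar>" for x
    using mult_right_mono[OF bd[of x], of "\<bar>u x\<bar>"] by (simp add: abs_mult mult.commute)
  show i: "integrable M (\<lambda>x. u x * v x)"
    by (rule Bochner_Integration.integrable_bound[of _ "\<lambda>x. L * \<bar>u x\<bar>"])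
      (use assms(1) le in \<open>auto intro: order_trans[OF _ abs_ge_self]\<close>)
  have "\<bar>\<integral>x. u x * v x \<partial>M\<bar> \<le> (\<integral>x. \<bar>u x * v x\<bar> \<partial>M)" by (rule integral_abs_bound)
  also have "\<dots> \<le> (\<integral>x. L * \<bar>u x\<bar> \<partial>M)"
    using i assms(1) le by (intro integral_mono) auto
  finally show "\<bar>\<integral>x. u x * v x \<partial>M\<bar> \<le> L * (\<integral>x. \<bar>u x\<bar> \<partial>M)" by simp
qed

text \<open>This is an exchange of limits for the limit case of induction on integrable functions,
  whose hypotheses on \<open>s\<close> it repeats. In its uses \<open>D i\<close> is the correlation
  sequence of the approximation \<open>s i\<close>, and its distance to \<open>C\<close> is bounded
  uniformly in time by an L1 distance.\<close>

lemma L1_approximation_tendsto_0: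
  fixes C :: "nat \<Rightarrow> real" and s :: "nat \<Rightarrow> 'a \<Rightarrow> real"
  assumes s: "\<And>i. integrable M (s i)" and f: "integrable M f"
    and conv: "\<And>x. x \<in> space M \<Longrightarrow> (\<lambda>i. s i x) \<longlonglongrightarrow> f x"
    and dom: "\<And>i x. x \<in> space M \<Longrightarrow> \<bar>s i x\<bar> \<le> 2 * \<bar>f x\<bar>"
    and C: "\<And>i. D i \<longlonglongrightarrow> 0" and close: "\<And>i j. \<bar>C j - D i j\<bar> \<le> R * (\<integral>x. \<bar>f x - s i x\<bar> \<partial>M)"
  shows "C \<longlonglongrightarrow> 0"
proof (rule LIMSEQ_I)
  fix e :: real assume "e > 0"
  have [measurable]: "f \<in> borel_measurable M" "s i \<in> borel_measurable M" for i using s f by auto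
  have "(\<lambda>i. \<integral>x. \<bar>f x - s i x\<bar> \<partial>M) \<longlonglongrightarrow> (\<integral>x. 0 \<partial>M)"
  \<comment> \<open>The factor 3 adds one for \<open>f\<close> and two for \<open>s i\<close>, by
    \<open>dom\<close>.\<close>
  proof (rule integral_dominated_convergence[where w = "\<lambda>x. 3 * \<bar>f x\<bar>"])
    show "AE x in M. (\<lambda>i. \<bar>f x - s i x\<bar>) \<longlonglongrightarrow> 0"
    proof (rule AE_I2)
      fix x assume "x \<in> space M"
      then have "(\<lambda>i. \<bar>f x - s i x\<bar>) \<longlonglongrightarrow> \<bar>f x - f x\<bar>"
        using conv by (intro tendsto_intros) auto
      then show "(\<lambda>i. \<bar>f x - s i x\<bar>) \<longlonglongrightarrow> 0" by simp
    qed
    show "AE x in M. norm \<bar>f x - s i x\<bar> \<le> 3 * \<bar>f x\<bar>" for i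
    proof (rule AE_I2)
      fix x assume "x \<in> space M"
      from dom[OF this, of i] show "norm \<bar>f x - s i x\<bar> \<le> 3 * \<bar>f x\<bar>" unfolding real_norm_def by linarith
    qed
  qed (use f in auto)
  then have "(\<lambda>i. R * (\<integral>x. \<bar>f x - s i x\<bar> \<partial>M)) \<longlonglongrightarrow> 0"
    using tendsto_mult_right_zero by simp
  then obtain i where "\<bar>R * (\<integral>x. \<bar>f x - s i x\<bar> \<partial>M)\<bar> < e / 2"
    using LIMSEQ_D[of _ 0 "e / 2"] \<open>e > 0\<close> by fastforce
  then have i: "\<bar>C j - D i j\<bar> < e / 2" for j using close[of j i] by linarith
  obtain n where "\<And>j. j \<ge> n \<Longrightarrow> \<bar>D i j\<bar> < e / 2"
    using LIMSEQ_D[OF C[of i], of "e / 2"] \<open>e > 0\<close> by auto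
  then have "\<bar>C j\<bar> < e" if "j \<ge> n" for j
    using i[of j] that by (smt (verit) field_sum_of_halves)
  then show "\<exists>n. \<forall>j\<ge>n. norm (C j - 0) < e" by auto
qed

text \<open>Strong mixing speaks of sets only. Linearity and L1 approximation extend it one argument
  at a time: first to an integrable first argument against an indicator, then to an integrable
  second argument against the fixed bounded \<open>f\<close>.\<close>

theorem strongly_mixing_correlation_tendsto_0:
  fixes f g :: "'a \<Rightarrow> real"
  assumes sm: "strongly_mixing T M"
    and f [measurable]: "f \<in> borel_measurable M" and g [measurable]: "g \<in> borel_measurable M"
    and bd: "\<And>x. \<bar>f x\<bar> \<le> K" "\<And>x. \<bar>g x\<bar> \<le> L"
  shows "correlation f g \<longlonglongrightarrow> 0"
proof -
  have sets: "correlation (indicat_real A) (indicat_real B) \<longlonglongrightarrow> 0"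
    if [measurable]: "A \<in> sets M" "B \<in> sets M" for A B
  proof -
    have "(\<integral>x. indicator A ((T ^^ j) x) * indicat_real B x \<partial>M) = measure M (((T ^^ j) -` A \<inter> space M) \<inter> B)" for j
    proof -
      have "(\<integral>x. indicator A ((T ^^ j) x) * indicat_real B x \<partial>M)
          = (\<integral>x. indicat_real (((T ^^ j) -` A \<inter> space M) \<inter> B) x \<partial>M)"
        by (intro Bochner_Integration.integral_cong) (auto simp: indicator_def)
      also have "\<dots> = measure M (((T ^^ j) -` A \<inter> space M) \<inter> B)" by simp
      finally show ?thesis .
    qed
    then have "correlation (indicat_real A) (indicat_real B)
        = (\<lambda>j. measure M (((T ^^ j) -` A \<inter> space M) \<inter> B) - measure M A * measure M B)"
      by (auto simp: correlation_def fun_eq_iff)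
    moreover have "\<dots> \<longlonglongrightarrow> measure M A * measure M B - measure M A * measure M B"
      using sm that by (intro tendsto_diff tendsto_const) (auto simp: strongly_mixing_def)
    ultimately show ?thesis by simp
  qed
  have step1: "correlation h (indicat_real B) \<longlonglongrightarrow> 0"
    if h: "integrable M h" and [measurable]: "B \<in> sets M" for h B
    using h
  proof induct
    case (base A c)
    have "correlation (\<lambda>x. indicator A x *\<^sub>R c) (indicat_real B) j = c * correlation (indicator A) (indicat_real B) j" for j
      by (simp add: correlation_def algebra_simps)
    then show ?case using tendsto_mult_right_zero[OF sets[OF base(1) that(2)], of c] by simp
  next
    case (add u v)
    have "correlation (\<lambda>x. u x + v x) (indicat_real B) j = correlation u (indicat_real B) j + correlation v (indicat_real B) j" for j
      using integrable_mult_bounded(1)[OF integrable_T_funpow[OF add(1), of j], of "indicat_real B" 1]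
        integrable_mult_bounded(1)[OF integrable_T_funpow[OF add(3), of j], of "indicat_real B" 1] add(1,3)
      by (simp add: correlation_def distrib_right)
    then show ?case using tendsto_add[OF add(2,4)] by simp
  next
    case (lim u s)
    show ?case
    proof (rule L1_approximation_tendsto_0[where D = "\<lambda>i. correlation (s i) (indicat_real B)" and R = 2, OF lim(1,5,3) _ lim(2)])
      fix i j
      have i: "integrable M (\<lambda>x. u x - s i x)" using lim by auto
      have "correlation u (indicat_real B) j - correlation (s i) (indicat_real B) j
          = correlation (\<lambda>x. u x - s i x) (indicat_real B) j"
        using integrable_mult_bounded(1)[OF integrable_T_funpow[OF lim(5), of j], of "indicat_real B" 1]
          integrable_mult_bounded(1)[OF integrable_T_funpow[OF lim(1)[of i], of j], of "indicat_real B" 1] lim(5) lim(1)[of i]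
        by (simp add: correlation_def left_diff_distrib)
      also have "\<bar>\<dots>\<bar> \<le> \<bar>\<integral>x. (u ((T ^^ j) x) - s i ((T ^^ j) x)) * indicat_real B x \<partial>M\<bar>
          + \<bar>expectation (\<lambda>x. u x - s i x)\<bar> * \<bar>expectation (indicat_real B)\<bar>"
        unfolding correlation_def abs_mult[symmetric] by (rule abs_triangle_ineq4)
      \<comment> \<open>The joint integral and the product of expectations contribute one copy of
        the L1 distance each, whence \<open>R = 2\<close>.\<close>
      also have "\<dots> \<le> (\<integral>x. \<bar>u x - s i x\<bar> \<partial>M) + (\<integral>x. \<bar>u x - s i x\<bar> \<partial>M) * 1"
      proof (intro add_mono mult_mono integral_abs_bound)
        show "\<bar>\<integral>x. (u ((T ^^ j) x) - s i ((T ^^ j) x)) * indicat_real B x \<partial>M\<bar> \<le> (\<integral>x. \<bar>u x - s i x\<bar> \<partial>M)"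
          using integrable_mult_bounded(2)[OF integrable_T_funpow[OF i, of j], of "indicat_real B" 1]
            integral_T_funpow[of "\<lambda>x. \<bar>u x - s i x\<bar>" j] i by simp
      qed (auto simp: i)
      finally show "\<bar>correlation u (indicat_real B) j - correlation (s i) (indicat_real B) j\<bar> \<le> 2 * (\<integral>x. \<bar>u x - s i x\<bar> \<partial>M)"
        by simp
    qed (use lim(4) in auto)
  qed
  have f_int: "integrable M f" using f bd(1) by (intro integrable_bounded[where K = K]) auto
  have Ef: "\<bar>expectation f\<bar> \<le> K"
    using integrable_mult_bounded(2)[of "\<lambda>_. 1" f K] bd(1) by (simp add: prob_space)
  \<comment> \<open>Here the first factor is bounded by \<open>K\<close>, so the error of
    approximating the merely integrable \<open>h\<close> is at most \<open>2 * K\<close> times an L1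
    distance.\<close>
  have step2: "correlation f h \<longlonglongrightarrow> 0" if h: "integrable M h" for h
    using h
  proof induct
    case (base B c)
    have "correlation f (\<lambda>x. indicator B x *\<^sub>R c) j = c * correlation f (indicat_real B) j" for j
      by (simp add: correlation_def algebra_simps)
    then show ?case using tendsto_mult_right_zero[OF step1[OF f_int base(1)], of c] by simp
  next
    case (add u v)
    have "correlation f (\<lambda>x. u x + v x) j = correlation f u j + correlation f v j" for j
      using integrable_mult_bounded(1)[OF add(1), of "\<lambda>x. f ((T ^^ j) x)" K] bd(1) integrable_mult_bounded(1)[OF add(3), of "\<lambda>x. f ((T ^^ j) x)" K] bd(1) add(1,3)
      by (simp add: correlation_def distrib_left distrib_right mult.commute)
    then show ?case using tendsto_add[OF add(2,4)] by simp
  next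
    case (lim u s)
    show ?case
    proof (rule L1_approximation_tendsto_0[where D = "\<lambda>i. correlation f (s i)" and R = "2 * K", OF lim(1,5,3) _ lim(2)])
      fix i j
      have i: "integrable M (\<lambda>x. u x - s i x)" using lim by auto
      have "correlation f u j - correlation f (s i) j = correlation f (\<lambda>x. u x - s i x) j"
        using integrable_mult_bounded(1)[OF lim(5), of "\<lambda>x. f ((T ^^ j) x)" K] bd(1) integrable_mult_bounded(1)[OF lim(1)[of i], of "\<lambda>x. f ((T ^^ j) x)" K]
          lim(5) lim(1)[of i]
        by (simp add: correlation_def right_diff_distrib left_diff_distrib mult.commute)
      also have "\<bar>\<dots>\<bar> \<le> \<bar>\<integral>x. f ((T ^^ j) x) * (u x - s i x) \<partial>M\<bar> + \<bar>expectation f\<bar> * \<bar>expectation (\<lambda>x. u x - s i x)\<bar>"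
        unfolding correlation_def abs_mult[symmetric] by (rule abs_triangle_ineq4)
      also have "\<dots> \<le> K * (\<integral>x. \<bar>u x - s i x\<bar> \<partial>M) + K * (\<integral>x. \<bar>u x - s i x\<bar> \<partial>M)"
      proof (intro add_mono mult_mono integral_abs_bound Ef)
        show "\<bar>\<integral>x. f ((T ^^ j) x) * (u x - s i x) \<partial>M\<bar> \<le> K * (\<integral>x. \<bar>u x - s i x\<bar> \<partial>M)"
          using integrable_mult_bounded(2)[OF i, of "\<lambda>x. f ((T ^^ j) x)" K] bd(1) by (simp add: mult.commute)
      qed (use Ef in auto)
      finally show "\<bar>correlation f u j - correlation f (s i) j\<bar> \<le> 2 * K * (\<integral>x. \<bar>u x - s i x\<bar> \<partial>M)"
        by simp
    qed (use lim(4) in auto)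
  qed
  have "integrable M g" using g bd(2) by (intro integrable_bounded[where K = L]) auto
  then show ?thesis by (rule step2)
qed

text \<open>Bilinearity expresses the correlation of complex functions through the four real
  correlations of their parts, to which the limit theorems apply.\<close>

lemma correlation_complex:
  fixes f g :: "'a \<Rightarrow> complex"
  assumes [measurable]: "f \<in> borel_measurable M" "g \<in> borel_measurable M"
    and bd: "\<And>x. cmod (f x) \<le> K" "\<And>x. cmod (g x) \<le> L"
  shows "Re (correlation f g j) = correlation (\<lambda>x. Re (f x)) (\<lambda>x. Re (g x)) j - correlation (\<lambda>x. Im (f x)) (\<lambda>x. Im (g x)) j"
    and "Im (correlation f g j) = correlation (\<lambda>x. Re (f x)) (\<lambda>x. Im (g x)) j + correlation (\<lambda>x. Im (f x)) (\<lambda>x. Re (g x)) j"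
proof -
  have part: "\<bar>Re (f x)\<bar> \<le> K" "\<bar>Im (f x)\<bar> \<le> K" "\<bar>Re (g x)\<bar> \<le> L" "\<bar>Im (g x)\<bar> \<le> L" for x
    using bd[of x] abs_Re_le_cmod[of "f x"] abs_Im_le_cmod[of "f x"]
      abs_Re_le_cmod[of "g x"] abs_Im_le_cmod[of "g x"] by linarith+
  have i: "integrable M f" "integrable M g" "integrable M (\<lambda>x. f ((T ^^ j) x) * g x)"
    using bd integrable_bounded[of f K] integrable_bounded[of g L] integrable_correlation[of f g K L] by auto
  have p: "integrable M (\<lambda>x. Re (f ((T ^^ j) x)) * Re (g x))" "integrable M (\<lambda>x. Im (f ((T ^^ j) x)) * Im (g x))"
    "integrable M (\<lambda>x. Re (f ((T ^^ j) x)) * Im (g x))" "integrable M (\<lambda>x. Im (f ((T ^^ j) x)) * Re (g x))"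
    using part by (auto intro!: integrable_correlation[where K = K and L = L, of "\<lambda>x. Re (f x)"]
        integrable_correlation[where K = K and L = L, of "\<lambda>x. Im (f x)"])
  have "Re (\<integral>x. f ((T ^^ j) x) * g x \<partial>M) = (\<integral>x. Re (f ((T ^^ j) x)) * Re (g x) \<partial>M) - (\<integral>x. Im (f ((T ^^ j) x)) * Im (g x) \<partial>M)"
    using p by (simp flip: integral_Re[OF i(3)])
  then show "Re (correlation f g j) = correlation (\<lambda>x. Re (f x)) (\<lambda>x. Re (g x)) j - correlation (\<lambda>x. Im (f x)) (\<lambda>x. Im (g x)) j"
    by (simp add: correlation_def i)
  have "Im (\<integral>x. f ((T ^^ j) x) * g x \<partial>M) = (\<integral>x. Re (f ((T ^^ j) x)) * Im (g x) \<partial>M) + (\<integral>x. Im (f ((T ^^ j) x)) * Re (g x) \<partial>M)"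
    using p by (simp flip: integral_Im[OF i(3)])
  then show "Im (correlation f g j) = correlation (\<lambda>x. Re (f x)) (\<lambda>x. Im (g x)) j + correlation (\<lambda>x. Im (f x)) (\<lambda>x. Re (g x)) j"
    by (simp add: correlation_def i algebra_simps)
qed

end

subsection \<open>Characters and Fourier uniqueness on the torus\<close>

lemma proj_torus_rep_torus [simp]: "proj_torus (rep_torus x) = x"
  by (rule Quotient3_abs_rep[OF Quotient3_torus])

lemma proj_torus_eq_iff: "proj_torus x = proj_torus y \<longleftrightarrow> (\<forall>i. x $ i - y $ i \<in> \<int>)"
  by (rule torus.abs_eq_iff)

lemma cis_2pi_eq_1_iff: "cis (2 * pi * t) = 1 \<longleftrightarrow> t \<in> \<int>"
proof
  assume "cis (2 * pi * t) = 1"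
  then obtain n :: int where "2 * pi * t = of_int (2 * n) * pi"
    unfolding cis_conv_exp exp_eq_1 by auto
  then have "t = of_int n" by simp
  then show "t \<in> \<int>" by simp
qed (rule cis_multiple_2pi)

lemma cis_2pi_eq_iff: "cis (2 * pi * s) = cis (2 * pi * t) \<longleftrightarrow> s - t \<in> \<int>"
proof -
  have "cis (2 * pi * s) = cis (2 * pi * t) \<longleftrightarrow> cis (2 * pi * s) / cis (2 * pi * t) = 1"
    by simp
  also have "\<dots> \<longleftrightarrow> cis (2 * pi * (s - t)) = 1"
    by (simp only: cis_divide right_diff_distrib)
  finally show ?thesis by (simp only: cis_2pi_eq_1_iff)
qed

lemma cis_integer_combination_cong:
  fixes k :: "int ^ 'n" and x y :: "real ^ 'n"
  assumes "\<And>i. x $ i - y $ i \<in> \<int>"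
  shows "cis (2 * pi * (\<Sum>j\<in>UNIV. real_of_int (k $ j) * x $ j))
      = cis (2 * pi * (\<Sum>j\<in>UNIV. real_of_int (k $ j) * y $ j))"
proof -
  have "(\<Sum>j\<in>UNIV. real_of_int (k $ j) * (x $ j - y $ j)) \<in> \<int>"
    using assms by (intro Ints_sum Ints_mult) auto
  then show ?thesis
    by (simp add: cis_2pi_eq_iff sum_subtractf right_diff_distrib)
qed

lift_definition torus_char :: "int ^ 'n \<Rightarrow> 'n torus \<Rightarrow> complex"
  is "\<lambda>k x. cis (2 * pi * (\<Sum>j\<in>UNIV. real_of_int (k $ j) * x $ j))"
  by (rule cis_integer_combination_cong)

lemma torus_char_proj:
  "torus_char k (proj_torus x) = cis (2 * pi * (\<Sum>j\<in>UNIV. real_of_int (k $ j) * x $ j))"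
  by (rule torus_char.abs_eq)

lemma torus_char_0 [simp]: "torus_char 0 x = 1"
  by (subst proj_torus_rep_torus[symmetric], subst torus_char_proj) simp

lemma torus_char_add: "torus_char (k + l) x = torus_char k x * torus_char l x"
proof -
  have "torus_char (k + l) (proj_torus y) = torus_char k (proj_torus y) * torus_char l (proj_torus y)" for y
    by (simp add: torus_char_proj cis_mult sum.distrib distrib_right distrib_left)
  from this[of "rep_torus x"] show ?thesis by simp
qed

lemma norm_torus_char [simp]: "cmod (torus_char k x) = 1"
  using torus_char_proj[of k "rep_torus x"] by simp

lemma torus_char_minus: "torus_char (- k) x = cnj (torus_char k x)"
proof -
  have "torus_char (- k) (proj_torus y) = cnj (torus_char k (proj_torus y))" for y
    by (simp add: torus_char_proj cis_cnj sum_negf)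
  from this[of "rep_torus x"] show ?thesis by simp
qed

text \<open>Pairing \<open>k\<close> with \<open>C x\<close> is pairing \<open>k C\<close> with
  \<open>x\<close>, by exchange of two finite sums. This dual action is why frequencies are row
  vectors, as in \<open>strongly_independent\<close>.\<close>

lemma torus_char_torus_map: "torus_char k (torus_map C x) = torus_char (k v* C) x"
proof -
  have "torus_char k (torus_map C (proj_torus y)) = torus_char (k v* C) (proj_torus y)" for y
  proof -
    have "(\<Sum>i\<in>UNIV. real_of_int (k $ i) * (map_matrix real_of_int C *v y) $ i)
        = (\<Sum>i\<in>UNIV. \<Sum>j\<in>UNIV. real_of_int (C $ i $ j * k $ i) * y $ j)"
      by (simp add: matrix_vector_mult_def sum_distrib_left mult_ac)
    also have "\<dots> = (\<Sum>j\<in>UNIV. real_of_int ((k v* C) $ j) * y $ j)"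
      by (subst sum.swap) (simp add: vector_matrix_mult_def sum_distrib_left sum_distrib_right mult_ac)
    finally show ?thesis by (simp add: torus_map.abs_eq torus_char_proj)
  qed
  from this[of "rep_torus x"] show ?thesis by simp
qed

lemma torus_char_funpow: "torus_char k ((torus_map A ^^ j) x) = torus_char (k v* matrix_power A j) x"
\<comment> \<open>One application of the map replaces the frequency by \<open>k v* A\<close>, so the
  induction hypothesis is used at a different \<open>k\<close>.\<close>
proof (induction j arbitrary: k)
  case 0
  then show ?case by (simp add: matrix_power_def)
next
  case (Suc j)
  have "torus_char k ((torus_map A ^^ Suc j) x) = torus_char ((k v* A) v* matrix_power A j) x"
    by (simp add: torus_char_torus_map Suc)
  also have "(k v* A) v* matrix_power A j = k v* matrix_power A (Suc j)"
    by (simp add: matrix_power_def vector_matrix_mul_assoc)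
  finally show ?case .
qed

section \<open>Topology of the torus\<close>

lemma continuous_torusI:
  fixes f :: "'n::finite torus \<Rightarrow> 'b::topological_space"
  assumes "continuous_on UNIV (\<lambda>x. f (proj_torus x))"
  shows "continuous_on UNIV f"
proof -
  have "open (f -` U)" if "open U" for U
  proof -
    have "proj_torus -` (f -` U) = (\<lambda>x. f (proj_torus x)) -` U" by auto
    also have "open \<dots>" using that assms by (rule open_vimage)
    finally show ?thesis by (simp add: open_torus_def)
  qed
  then show ?thesis by (simp add: continuous_on_open_vimage[OF open_UNIV])
qed

lemma continuous_torus_char: "continuous_on UNIV (torus_char k)"
proof (rule continuous_torusI)
  show "continuous_on UNIV (\<lambda>x. torus_char k (proj_torus x))"
    unfolding torus_char_proj cis_conv_exp by (intro continuous_intros)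
qed

lemma torus_char_axis:
  "torus_char (axis j 1) (proj_torus x) = cis (2 * pi * x $ j)"
proof -
  have "(\<Sum>i\<in>UNIV. real_of_int (axis j 1 $ i) * x $ i) = (\<Sum>i\<in>UNIV. if i = j then x $ i else 0)"
    by (intro sum.cong) (auto simp: axis_def)
  then show ?thesis by (simp add: torus_char_proj)
qed

text \<open>The coordinate characters determine every coordinate modulo 1. This gives the Hausdorff
  property, the injectivity of \<open>torus_embed\<close> and the separation of points for
  Stone-Weierstrass.\<close>

lemma torus_eqI:
  assumes "\<And>j. torus_char (axis j 1) x = torus_char (axis j 1) y"
  shows "x = y"
proof -
  have "proj_torus (rep_torus x) = proj_torus (rep_torus y)"
    unfolding proj_torus_eq_iff
    using assms torus_char_axis[of _ "rep_torus x"] torus_char_axis[of _ "rep_torus y"]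
    by (simp add: cis_2pi_eq_iff)
  then show ?thesis by simp
qed

text \<open>Disjoint neighbourhoods are pulled back along a character that separates the points. As
  a consequence singletons are Borel sets, which all statements on atoms rely on.\<close>

instance torus :: (finite) t2_space
proof
  fix x y :: "'a torus" assume "x \<noteq> y"
  then obtain j where "torus_char (axis j 1) x \<noteq> torus_char (axis j 1) y"
    using torus_eqI by blast
  then obtain U V where UV: "open U" "open V" "torus_char (axis j 1) x \<in> U"
    "torus_char (axis j 1) y \<in> V" "U \<inter> V = {}"
    using hausdorff by metis
  have "open (torus_char (axis j 1) -` W)" if "open W" for W
    using that continuous_torus_char by (rule open_vimage)
  with UV show "\<exists>U V. open U \<and> open V \<and> x \<in> U \<and> y \<in> V \<and> U \<inter> V = {}"
    by (intro exI[of _ "torus_char (axis j 1) -` U"] exI[of _ "torus_char (axis j 1) -` V"]) auto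
qed

lemma compact_torus: "compact (UNIV :: 'n::finite torus set)"
proof -
  have "x \<in> proj_torus ` cbox 0 1" for x :: "'n torus"
  proof
    let ?y = "\<chi> i. frac (rep_torus x $ i)"
    have "proj_torus ?y = proj_torus (rep_torus x)"
      unfolding proj_torus_eq_iff by (simp add: frac_def)
    then show "x = proj_torus ?y" by simp
    show "?y \<in> cbox 0 1"
      by (auto simp: mem_box_cart frac_lt_1 less_imp_le)
  qed
  then have "proj_torus ` cbox 0 1 = (UNIV :: 'n torus set)" by auto
  moreover have "compact (proj_torus ` cbox 0 1 :: 'n torus set)"
    by (intro compact_continuous_image continuous_on_subset[OF continuous_proj_torus]) auto
  ultimately show ?thesis by simp
qed

text \<open>The torus carries no metric here; distances are measured in the image of this embedding.\<close>

definition torus_embed :: "'n::finite torus \<Rightarrow> complex ^ 'n" where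
  "torus_embed x = (\<chi> j. torus_char (axis j 1) x)"

lemma continuous_torus_embed: "continuous_on UNIV torus_embed"
  unfolding torus_embed_def by (intro continuous_on_vec_lambda continuous_torus_char)

lemma inj_torus_embed: "inj torus_embed"
  by (auto intro!: injI torus_eqI simp: torus_embed_def vec_eq_iff)

section \<open>Trigonometric polynomials and Fourier uniqueness\<close>

inductive trig_poly :: "('n::finite torus \<Rightarrow> complex) \<Rightarrow> bool" where
  trig_poly_char: "trig_poly (\<lambda>x. c * torus_char k x)"
| trig_poly_add: "trig_poly f \<Longrightarrow> trig_poly g \<Longrightarrow> trig_poly (\<lambda>x. f x + g x)"

lemma trig_poly_mult_char: "trig_poly f \<Longrightarrow> trig_poly (\<lambda>x. f x * (c * torus_char k x))"
proof (induction rule: trig_poly.induct)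
  case (trig_poly_char d l)
  show ?case
    using trig_poly.trig_poly_char[of "d * c" "l + k"] by (simp add: torus_char_add mult_ac)
next
  case (trig_poly_add f g)
  then show ?case
    using trig_poly.trig_poly_add[of "\<lambda>x. f x * (c * torus_char k x)" "\<lambda>x. g x * (c * torus_char k x)"]
    by (simp add: distrib_right)
qed

lemma trig_poly_mult: "trig_poly g \<Longrightarrow> trig_poly f \<Longrightarrow> trig_poly (\<lambda>x. f x * g x)"
proof (induction rule: trig_poly.induct)
  case (trig_poly_add g h)
  then show ?case
    using trig_poly.trig_poly_add[of "\<lambda>x. f x * g x" "\<lambda>x. f x * h x"] by (simp add: distrib_left)
qed (rule trig_poly_mult_char)

lemma continuous_trig_poly: "trig_poly f \<Longrightarrow> continuous_on UNIV f"
proof (induction rule: trig_poly.induct)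
  case (trig_poly_char c k)
  show ?case by (intro continuous_on_mult_left continuous_torus_char)
qed (rule continuous_on_add)

text \<open>Stone-Weierstrass is applied to the real functions whose complex embedding is a
  trigonometric polynomial. Conjugation negates a frequency, so real and imaginary parts of
  characters belong to this algebra, and they separate points.\<close>

lemma trig_poly_dense:
  fixes f :: "'n::finite torus \<Rightarrow> real"
  assumes "continuous_on UNIV f" "e > 0"
  shows "\<exists>g. trig_poly (\<lambda>x. complex_of_real (g x)) \<and> (\<forall>x. \<bar>f x - g x\<bar> < e)"
proof -
  define P where "P = (\<lambda>g :: 'n torus \<Rightarrow> real. trig_poly (\<lambda>x. complex_of_real (g x)))"
  have const: "P (\<lambda>x. c)" for c
    using trig_poly_char[of "of_real c" 0] by (simp add: P_def)
  have cont: "continuous_on UNIV g" if "P g" for g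
    using continuous_on_Re[OF continuous_trig_poly[OF that[unfolded P_def]]] by simp
  have add: "P (\<lambda>x. g x + h x)" if "P g \<and> P h" for g h
    using that trig_poly_add[of "\<lambda>x. complex_of_real (g x)" "\<lambda>x. complex_of_real (h x)"]
    by (simp add: P_def)
  have mult: "P (\<lambda>x. g x * h x)" if "P g \<and> P h" for g h
    using that trig_poly_mult[of "\<lambda>x. complex_of_real (h x)" "\<lambda>x. complex_of_real (g x)"]
    by (simp add: P_def)
  have re: "complex_of_real (Re z) = 1/2 * z + 1/2 * cnj z"
    and im: "complex_of_real (Im z) = (- \<i>/2) * z + (\<i>/2) * cnj z" for z
    by (simp_all add: complex_eq_iff)
  have P_Re: "P (\<lambda>x. Re (torus_char k x))" for k
    unfolding P_def re torus_char_minus[symmetric] by (intro trig_poly_add trig_poly_char)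
  have P_Im: "P (\<lambda>x. Im (torus_char k x))" for k
    unfolding P_def im torus_char_minus[symmetric] by (intro trig_poly_add trig_poly_char)
  have sep: "\<exists>g. P g \<and> g x \<noteq> g y" if "x \<noteq> y" for x y
  proof -
    obtain j where "torus_char (axis j 1) x \<noteq> torus_char (axis j 1) y"
      using \<open>x \<noteq> y\<close> torus_eqI by blast
    then consider "Re (torus_char (axis j 1) x) \<noteq> Re (torus_char (axis j 1) y)"
      | "Im (torus_char (axis j 1) x) \<noteq> Im (torus_char (axis j 1) y)"
      by (auto simp: complex_eq_iff)
    then show ?thesis
    proof cases
      case 1
      then show ?thesis by (intro exI[of _ "\<lambda>x. Re (torus_char (axis j 1) x)"] conjI P_Re)
    next
      case 2
      then show ?thesis by (intro exI[of _ "\<lambda>x. Im (torus_char (axis j 1) x)"] conjI P_Im)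
    qed
  qed
  have "\<exists>g. P g \<and> (\<forall>x\<in>UNIV. \<bar>f x - g x\<bar> < e)"
    by (rule Stone_Weierstrass_HOL[where P = P, OF compact_torus const cont add mult _ assms])
      (use sep in simp_all)
  then show ?thesis by (simp add: P_def)
qed

lemma borel_probability_integrable:
  fixes f :: "'n::finite torus \<Rightarrow> 'b::{banach, second_countable_topology}"
  assumes "borel_probability \<mu>" "continuous_on UNIV f"
  shows "integrable \<mu> f"
proof -
  interpret prob_space \<mu> using assms by (simp add: borel_probability_def)
  have sets: "sets \<mu> = sets borel" using assms by (simp add: borel_probability_def)
  have "f \<in> borel_measurable \<mu>"
    using borel_measurable_continuous_onI[OF assms(2)] measurable_cong_sets[OF sets refl] by blast
  moreover have "bounded (range f)"
    using compact_continuous_image[OF assms(2) compact_torus] by (rule compact_imp_bounded)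
  then obtain K where "\<And>x. norm (f x) \<le> K" by (auto simp: bounded_iff)
  ultimately show ?thesis by (intro integrable_const_bound[where B = K]) auto
qed

text \<open>By linearity the integrals agree on trigonometric polynomials; uniform approximation
  within \<open>e / 2\<close> costs at most \<open>e / 2\<close> for each measure.\<close>

lemma integral_continuous_eq:
  fixes f :: "'n::finite torus \<Rightarrow> real"
  assumes \<mu>: "borel_probability \<mu>" and \<nu>: "borel_probability \<nu>"
    and eq: "\<And>k. (\<integral>x. torus_char k x \<partial>\<mu>) = (\<integral>x. torus_char k x \<partial>\<nu>)"
    and f: "continuous_on UNIV f"
  shows "(\<integral>x. f x \<partial>\<mu>) = (\<integral>x. f x \<partial>\<nu>)"
proof -
  have poly: "(\<integral>x. g x \<partial>\<mu>) = (\<integral>x. g x \<partial>\<nu>)" if "trig_poly g" for g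
    using that
  proof (induction rule: trig_poly.induct)
    case (trig_poly_add g h)
    then show ?case
      using borel_probability_integrable[OF \<mu> continuous_trig_poly]
        borel_probability_integrable[OF \<nu> continuous_trig_poly] by simp
  qed (simp add: eq)
  interpret \<mu>: prob_space \<mu> using \<mu> by (simp add: borel_probability_def)
  interpret \<nu>: prob_space \<nu> using \<nu> by (simp add: borel_probability_def)
  \<comment> \<open>The summand 0 gives the shape expected by
    \<open>field_le_epsilon\<close>.\<close>
  have "\<bar>(\<integral>x. f x \<partial>\<mu>) - (\<integral>x. f x \<partial>\<nu>)\<bar> \<le> 0 + e" if "e > 0" for e
  proof -
    obtain g where g: "trig_poly (\<lambda>x. complex_of_real (g x))" and fg: "\<And>x. \<bar>f x - g x\<bar> < e / 2"
      using trig_poly_dense[OF f, of "e / 2"] \<open>e > 0\<close> by auto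
    have cont: "continuous_on UNIV g"
      using continuous_on_Re[OF continuous_trig_poly[OF g]] by simp
    have close: "\<bar>(\<integral>x. f x \<partial>M) - (\<integral>x. g x \<partial>M)\<bar> \<le> e / 2" if M: "borel_probability M" for M
    proof -
      interpret M: prob_space M using M by (simp add: borel_probability_def)
      have i: "integrable M f" "integrable M g"
        using borel_probability_integrable[OF M] f cont by auto
      have "\<bar>\<integral>x. f x - g x \<partial>M\<bar> \<le> (\<integral>x. \<bar>f x - g x\<bar> \<partial>M)" by (rule integral_abs_bound)
      also have "\<dots> \<le> (\<integral>x. e / 2 \<partial>M)"
        using i fg by (intro integral_mono) (auto intro: less_imp_le)
      finally show ?thesis using i by (simp add: M.prob_space)
    qed
    have "(\<integral>x. g x \<partial>\<mu>) = (\<integral>x. g x \<partial>\<nu>)"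
      using poly[OF g] by simp
    then show ?thesis using close[OF \<mu>] close[OF \<nu>] by linarith
  qed
  then have "\<bar>(\<integral>x. f x \<partial>\<mu>) - (\<integral>x. f x \<partial>\<nu>)\<bar> \<le> 0" by (rule field_le_epsilon)
  then show ?thesis by simp
qed

text \<open>The tent functions decrease to the indicator of \<open>C\<close>: the image of
  \<open>C\<close> is compact and the embedding injective, so the distance vanishes exactly on
  \<open>C\<close>. Dominated convergence does the rest.\<close>

lemma measure_closed_limit:
  fixes C :: "'n::finite torus set"
  assumes M: "borel_probability M" and C: "closed C" "C \<noteq> {}"
  shows "(\<lambda>m. \<integral>x. max 0 (1 - real m * infdist (torus_embed x) (torus_embed ` C)) \<partial>M) \<longlonglongrightarrow> measure M C"
proof -
  interpret prob_space M using M by (simp add: borel_probability_def)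
  have sets: "sets M = sets borel" using M by (simp add: borel_probability_def)
  let ?d = "\<lambda>x. infdist (torus_embed x) (torus_embed ` C)"
  have "compact C" using compact_Int_closed[OF compact_torus C(1)] by simp
  then have "compact (torus_embed ` C)"
    by (intro compact_continuous_image continuous_on_subset[OF continuous_torus_embed]) auto
  then have cl: "closed (torus_embed ` C)" by (rule compact_imp_closed)
  have d0: "?d x = 0 \<longleftrightarrow> x \<in> C" for x
    using in_closed_iff_infdist_zero[OF cl, of "torus_embed x"] C(2) inj_torus_embed
    by (auto dest: injD)
  have cont: "continuous_on UNIV (\<lambda>x. max 0 (1 - real m * ?d x))" for m
    by (intro continuous_intros continuous_torus_embed)
  have "(\<lambda>m. \<integral>x. max 0 (1 - real m * ?d x) \<partial>M) \<longlonglongrightarrow> (\<integral>x. indicat_real C x \<partial>M)"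
  proof (rule integral_dominated_convergence[where w = "\<lambda>_. 1"])
    show "indicat_real C \<in> borel_measurable M"
      using C(1) sets by (intro borel_measurable_indicator) auto
    show "(\<lambda>x. max 0 (1 - real m * ?d x)) \<in> borel_measurable M" for m
      using borel_measurable_continuous_onI[OF cont[of m]] measurable_cong_sets[OF sets refl] by blast
    show "AE x in M. norm (max 0 (1 - real m * ?d x)) \<le> 1" for m
      by (auto simp: infdist_nonneg)
    show "AE x in M. (\<lambda>m. max 0 (1 - real m * ?d x)) \<longlonglongrightarrow> indicat_real C x"
    proof (rule AE_I2)
      fix x
      show "(\<lambda>m. max 0 (1 - real m * ?d x)) \<longlonglongrightarrow> indicat_real C x"
      proof (cases "x \<in> C")
        case True
        then show ?thesis using d0[of x] by simp
      next
        case False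
        then have "?d x > 0" using d0[of x] infdist_nonneg[of "torus_embed x" "torus_embed ` C"] by linarith
        then obtain n where n: "1 < real n * ?d x" using reals_Archimedean3 by blast
        have "max 0 (1 - real m * ?d x) = 0" if "m \<ge> n" for m
        proof -
          have "real n * ?d x \<le> real m * ?d x" using that \<open>?d x > 0\<close> by (intro mult_right_mono) auto
          then show ?thesis using n by simp
        qed
        then have "(\<lambda>m. max 0 (1 - real m * ?d x)) \<longlonglongrightarrow> 0"
          by (intro tendsto_eventually eventually_sequentiallyI[of n]) auto
        then show ?thesis using False by simp
      qed
    qed
  qed simp
  then show ?thesis using sets C(1) by (simp add: sets_eq_imp_space_eq)
qed

text \<open>Closed sets generate the Borel sets and are stable under intersection, and their
  measures are limits of integrals of continuous functions.\<close>

theorem torus_fourier_uniqueness: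
  fixes \<mu> \<nu> :: "'n::finite torus measure"
  assumes \<mu>: "borel_probability \<mu>" and \<nu>: "borel_probability \<nu>"
    and eq: "\<And>k. (\<integral>x. torus_char k x \<partial>\<mu>) = (\<integral>x. torus_char k x \<partial>\<nu>)"
  shows "\<mu> = \<nu>"
proof (rule measure_eqI_generator_eq[where E = "Collect closed" and \<Omega> = UNIV and A = "\<lambda>_. UNIV"])
  interpret \<mu>: prob_space \<mu> using \<mu> by (simp add: borel_probability_def)
  interpret \<nu>: prob_space \<nu> using \<nu> by (simp add: borel_probability_def)
  show "sets \<mu> = sigma_sets UNIV (Collect closed)" "sets \<nu> = sigma_sets UNIV (Collect closed)"
    using \<mu> \<nu> by (simp_all add: borel_probability_def borel_eq_closed)
  show "emeasure \<mu> C = emeasure \<nu> C" if "C \<in> Collect closed" for C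
  proof (cases "C = {}")
    \<comment> \<open>The distance to the empty set is 0 by convention, so the tent functions of the
      empty set would be constantly 1; that set is treated apart.\<close>
    case False
    have C: "closed C" using that by simp
    have "(\<integral>x. max 0 (1 - real m * infdist (torus_embed x) (torus_embed ` C)) \<partial>\<mu>)
        = (\<integral>x. max 0 (1 - real m * infdist (torus_embed x) (torus_embed ` C)) \<partial>\<nu>)" for m
      by (intro integral_continuous_eq \<mu> \<nu> eq continuous_intros continuous_torus_embed)
    then have "measure \<mu> C = measure \<nu> C"
      using measure_closed_limit[OF \<mu> C False] measure_closed_limit[OF \<nu> C False]
      by (simp add: LIMSEQ_unique)
    then show ?thesis by (simp add: \<mu>.emeasure_eq_measure \<nu>.emeasure_eq_measure)
  qed simp
  show "emeasure \<mu> UNIV \<noteq> \<infinity>" by simp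
qed (auto intro: Int_stableI)

section \<open>Fourier coefficients of the Lebesgue measure\<close>

lemma integral_cis_unit_interval:
  assumes "r \<in> \<int>" "r \<noteq> 0"
  shows "(\<integral>t. indicator {0..1} t *\<^sub>R cis (2 * pi * (r * t)) \<partial>lborel) = 0"
proof -
  \<comment> \<open>The antiderivative \<open>exp (c * t) / c\<close> takes the same value at 0 and
    1 because \<open>r\<close> is an integer.\<close>
  define c where "c = \<i> * complex_of_real (2 * pi * r)"
  have c: "c \<noteq> 0" using assms by (simp add: c_def)
  have cis: "cis (2 * pi * (r * t)) = exp (c * complex_of_real t)" for t
    by (simp add: cis_conv_exp c_def mult_ac)
  have "((\<lambda>t. exp (c * complex_of_real t) / c) has_vector_derivative exp (c * complex_of_real t)) (at t within {0..1})" for t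
  proof -
    have "((\<lambda>z. exp (c * z) / c) has_field_derivative exp (c * complex_of_real t)) (at (complex_of_real t))"
      using c by (auto intro!: derivative_eq_intros)
    then show ?thesis by (rule has_vector_derivative_real_field)
  qed
  then have "(\<integral>t. indicator {0..1} t *\<^sub>R exp (c * complex_of_real t) \<partial>lborel)
      = exp (c * complex_of_real 1) / c - exp (c * complex_of_real 0) / c"
    by (intro integral_FTC_Icc) (auto intro!: continuous_intros)
  moreover have "exp (c * complex_of_real 1) = 1"
    using cis[of 1] assms by simp
  ultimately show ?thesis by (simp add: cis)
qed

text \<open>Over the unit cube the character is a product of functions of single coordinates. A
  coordinate in which \<open>k\<close> does not vanish contributes a zero integral.\<close>

lemma lebesgue_torus_char:
  fixes k :: "int ^ 'n::finite"
  assumes "k \<noteq> 0"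
  shows "(\<integral>x. torus_char k x \<partial>(lebesgue_torus :: 'n torus measure)) = 0"
proof -
  define K :: "real ^ 'n" where "K = (\<chi> j. real_of_int (k $ j))"
  \<comment> \<open>Each factor carries the indicator of the unit interval, so that the integral
    over the cube becomes one over the whole space.\<close>
  define h where "h b t = indicator {0..1} t *\<^sub>R cis (2 * pi * ((K \<bullet> b) * t))" for b and t :: real
  let ?Q = "cbox 0 1 :: (real ^ 'n) set"
  have [measurable]: "torus_char k \<in> borel_measurable borel"
    by (intro borel_measurable_continuous_onI continuous_torus_char)
  have "measure lborel ?Q = 1"
    by (subst content_cbox_cart) (auto simp: interval_ne_empty_cart)
  then have Q: "emeasure lborel ?Q = 1"
    using emeasure_lborel_cbox_finite[of 0 "1 :: real ^ 'n"]
    by (metis emeasure_eq_ennreal_measure ennreal_1 infinity_ennreal_def order_less_irrefl)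
  have unif: "uniform_measure lborel ?Q = density lborel (\<lambda>x. ennreal (indicator ?Q x))"
    by (simp add: uniform_measure_def Q ennreal_indicator divide_ennreal_def)
  have char_prod: "indicator ?Q x *\<^sub>R torus_char k (proj_torus x) = (\<Prod>b\<in>Basis. h b (x \<bullet> b))" for x :: "real ^ 'n"
  proof -
    have "(\<Sum>j\<in>UNIV. real_of_int (k $ j) * x $ j) = K \<bullet> x"
      by (simp add: K_def inner_vec_def)
    also have "\<dots> = (\<Sum>b\<in>Basis. (K \<bullet> b) * (x \<bullet> b))"
      by (rule euclidean_inner)
    finally have 1: "torus_char k (proj_torus x) = (\<Prod>b\<in>Basis. cis (2 * pi * ((K \<bullet> b) * (x \<bullet> b))))"
      by (simp add: torus_char_proj cis_conv_exp sum_distrib_left exp_sum)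
    have one: "(1 :: real ^ 'n) \<bullet> b = 1" if "b \<in> Basis" for b
      using that by (auto simp: Basis_vec_def inner_axis)
    have "(\<Prod>b\<in>(Basis :: (real ^ 'n) set). indicat_real {0..1} (x \<bullet> b)) = indicator ?Q x"
    proof (cases "x \<in> ?Q")
      case True
      then show ?thesis by (simp add: mem_box one)
    next
      case False
      then obtain b where "b \<in> Basis" "indicat_real {0..1} (x \<bullet> b) = 0"
        by (auto simp: mem_box one)
      then have "(\<Prod>b\<in>(Basis :: (real ^ 'n) set). indicat_real {0..1} (x \<bullet> b)) = 0"
        by (intro prod_zero) auto
      then show ?thesis using False by simp
    qed
    then show ?thesis
      by (simp add: 1 h_def scaleR_conv_of_real prod.distrib flip: of_real_prod)
  qed
  interpret product_sigma_finite "\<lambda>b :: real ^ 'n. lborel :: real measure" ..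
  have [measurable]: "h b \<in> borel_measurable borel" for b
    unfolding h_def by (intro borel_measurable_scaleR borel_measurable_indicator borel_measurable_continuous_onI)
      (auto intro!: continuous_intros simp: cis_conv_exp)
  have int_h: "integrable lborel (h b)" for b
    unfolding h_def cis_conv_exp
    by (intro borel_integrable_compact) (auto intro!: continuous_intros)
  obtain j where j: "k $ j \<noteq> 0" using assms by (auto simp: vec_eq_iff)
  have "(\<integral>x. torus_char k x \<partial>(lebesgue_torus :: 'n torus measure))
      = (\<integral>x. torus_char k (proj_torus x) \<partial>uniform_measure lborel ?Q)"
    unfolding lebesgue_torus_def by (rule integral_distr) measurable
  also have "\<dots> = (\<integral>x. indicator ?Q x *\<^sub>R torus_char k (proj_torus x) \<partial>lborel)"
    unfolding unif by (rule integral_density) auto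
  also have "\<dots> = (\<integral>x. (\<Prod>b\<in>Basis. h b (x \<bullet> b)) \<partial>lborel)"
    by (simp only: char_prod)
  \<comment> \<open>By \<open>lborel_eq\<close>, \<open>lborel\<close> is the image of a product of
    one-dimensional measures indexed by \<open>Basis\<close>, which brings the integral into product
    form.\<close>
  also have "\<dots> = (\<integral>f. (\<Prod>b\<in>Basis. h b ((\<Sum>b\<in>Basis. f b *\<^sub>R b) \<bullet> b)) \<partial>(\<Pi>\<^sub>M b\<in>(Basis :: (real ^ 'n) set). lborel))"
    by (subst lborel_eq) (rule integral_distr; measurable)
  also have "\<dots> = (\<integral>f. (\<Prod>b\<in>Basis. h b (f b)) \<partial>(\<Pi>\<^sub>M b\<in>(Basis :: (real ^ 'n) set). lborel))"
    by (intro Bochner_Integration.integral_cong prod.cong refl) simp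
  also have "\<dots> = (\<Prod>b\<in>(Basis :: (real ^ 'n) set). \<integral>t. h b t \<partial>lborel)"
    by (rule product_integral_prod) (auto simp: int_h)
  also have "\<dots> = 0"
  proof (rule prod_zero)
    have "(\<integral>t. h (axis j 1) t \<partial>lborel) = 0"
      unfolding h_def using j by (intro integral_cis_unit_interval) (auto simp: K_def inner_axis)
    then show "\<exists>b\<in>(Basis :: (real ^ 'n) set). (\<integral>t. h b t \<partial>lborel) = 0"
      by (intro bexI[of _ "axis j 1"]) (auto simp: axis_in_Basis_iff)
  qed simp
  finally show ?thesis .
qed

lemma borel_probability_lebesgue_torus: "borel_probability lebesgue_torus"
  using prob_space_lebesgue_torus by (simp add: borel_probability_def lebesgue_torus_def)

lemma eq_lebesgue_torusI:
  assumes \<mu>: "borel_probability \<mu>" and "\<And>k. k \<noteq> 0 \<Longrightarrow> (\<integral>x. torus_char k x \<partial>\<mu>) = 0"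
  shows "\<mu> = lebesgue_torus"
proof (rule torus_fourier_uniqueness[OF \<mu> borel_probability_lebesgue_torus])
  fix k
  interpret \<mu>: prob_space \<mu> using \<mu> by (simp add: borel_probability_def)
  interpret l: prob_space lebesgue_torus by (rule prob_space_lebesgue_torus)
  show "(\<integral>x. torus_char k x \<partial>\<mu>) = (\<integral>x. torus_char k x \<partial>lebesgue_torus)"
    using assms(2) by (cases "k = 0") (simp_all add: lebesgue_torus_char \<mu>.prob_space l.prob_space)
qed

section \<open>Characters of mean 1 and atoms\<close>

lemma (in prob_space) AE_eq_1_of_expectation_eq_1:
  fixes f :: "'a \<Rightarrow> complex"
  assumes f [measurable]: "f \<in> borel_measurable M" and norm: "\<And>x. cmod (f x) = 1"
    and 1: "expectation f = 1"
  shows "AE x in M. f x = 1"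
proof -
  have i: "integrable M f" using f norm by (intro integrable_const_bound[where B = 1]) auto
  have le: "Re (f x) \<le> 1" for x using complex_Re_le_cmod[of "f x"] norm[of x] by simp
  \<comment> \<open>A nonnegative function with integral zero vanishes almost everywhere; once the
    real part is 1, modulus 1 leaves no imaginary part.\<close>
  have "(\<integral>x. 1 - Re (f x) \<partial>M) = 0"
    using i 1 by (simp add: prob_space)
  moreover have "integrable M (\<lambda>x. 1 - Re (f x))" using i by auto
  ultimately have "AE x in M. 1 - Re (f x) = 0"
    using le by (subst (asm) integral_nonneg_eq_0_iff_AE) auto
  then show ?thesis
  proof eventually_elim
    case (elim x)
    then have "(Re (f x))\<^sup>2 + (Im (f x))\<^sup>2 = 1" using norm[of x] by (simp add: cmod_def)
    with elim show ?case by (simp add: complex_eq_iff)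
  qed
qed

text \<open>Almost every point lies in the set \<open>S\<close> where all these characters equal 1.
  Lifted to real vectors, \<open>S\<close> consists of points whose inner products with the spanning
  vectors \<open>v i\<close> are integers, and these integers determine the point. So
  \<open>S\<close> is countable, and without atoms it would be a null set of full measure.\<close>

lemma strongly_independent_atom:
  fixes \<mu> :: "'n::finite torus measure"
  assumes \<mu>: "borel_probability \<mu>" and B: "strongly_independent B" and k: "k \<noteq> 0"
    and 1: "\<And>i. (\<integral>x. torus_char (k v* B i) x \<partial>\<mu>) = 1"
  shows "\<exists>x. measure \<mu> {x} \<noteq> 0"
proof (rule ccontr)
  assume no_atom: "\<not> ?thesis"
  interpret prob_space \<mu> using \<mu> by (simp add: borel_probability_def)
  have sets: "sets \<mu> = sets borel" using \<mu> by (simp add: borel_probability_def)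
  have meas [measurable]: "torus_char l \<in> borel_measurable \<mu>" for l
    using borel_probability_integrable[OF \<mu> continuous_torus_char] by auto
  define v :: "'n \<Rightarrow> real ^ 'n" where "v i = (\<chi> j. real_of_int ((k v* B i) $ j))" for i
  have v: "v = (\<lambda>i. \<chi> j. real_of_int ((k v* B i) $ j))" by (simp add: v_def fun_eq_iff)
  have ind: "inj v" "independent (range v)"
    using B k unfolding strongly_independent_def Let_def v by blast+
  have "card (range v) = dim (UNIV :: (real ^ 'n) set)"
    using card_image[OF ind(1)] by simp
  then have span: "UNIV \<subseteq> span (range v)"
    using card_eq_dim[of "range v" UNIV] ind(2) by simp
  define S where "S = {x. \<forall>i. torus_char (k v* B i) x = 1}"
  define S' where "S' = {y. \<forall>i. v i \<bullet> y \<in> \<int>}"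
  have floor: "real_of_int \<lfloor>v i \<bullet> y\<rfloor> = v i \<bullet> y" if "y \<in> S'" for i y
    using that unfolding S'_def by (metis (mono_tags, lifting) Ints_cases floor_of_int mem_Collect_eq)
  \<comment> \<open>On \<open>S'\<close> the floors are the exact inner products, so
    \<open>fl\<close> codes a point by its integer vector.\<close>
  define fl :: "real ^ 'n \<Rightarrow> int ^ 'n" where "fl y = (\<chi> i. \<lfloor>v i \<bullet> y\<rfloor>)" for y
  have "inj_on fl S'"
  proof (rule inj_onI)
    fix y z assume y: "y \<in> S'" and z: "z \<in> S'" and eq: "fl y = fl z"
    have eq': "v i \<bullet> y = v i \<bullet> z" for i
    proof -
      have "fl y $ i = fl z $ i" by (simp only: eq)
      then have "\<lfloor>v i \<bullet> y\<rfloor> = \<lfloor>v i \<bullet> z\<rfloor>" by (simp only: fl_def vec_lambda_beta)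
      then show ?thesis using floor[OF y, of i] floor[OF z, of i] by metis
    qed
    have "w \<bullet> (y - z) = 0" if "w \<in> span (range v)" for w
      using that by (induction rule: span_induct_alt) (auto simp: inner_add_left inner_diff_right eq')
    then have "(y - z) \<bullet> (y - z) = 0" using span by blast
    then show "y = z" by simp
  qed
  then have "countable S'" by (rule countableI')
  moreover have "S \<subseteq> proj_torus ` S'"
  proof
    fix x assume "x \<in> S"
    then have "torus_char (k v* B i) (proj_torus (rep_torus x)) = 1" for i by (simp add: S_def)
    then have "rep_torus x \<in> S'"
      unfolding torus_char_proj cis_2pi_eq_1_iff by (simp add: S'_def v_def inner_vec_def)
    then show "x \<in> proj_torus ` S'" by (metis imageI proj_torus_rep_torus)
  qed
  ultimately have "countable S" by (meson countable_image countable_subset)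
  then have "(\<Union>x\<in>S. {x}) \<in> null_sets \<mu>"
    using no_atom by (intro null_sets_UN') (auto simp: null_sets_def sets emeasure_eq_measure)
  then have "AE x in \<mu>. x \<notin> S" by (simp add: AE_not_in)
  moreover have "AE x in \<mu>. \<forall>i\<in>UNIV. torus_char (k v* B i) x = 1"
    by (intro AE_finite_allI AE_eq_1_of_expectation_eq_1 1) auto
  ultimately have "AE x in \<mu>. False" by eventually_elim (simp add: S_def)
  then show False by simp
qed

subsection \<open>Rigidity of invariant measures\<close>

context measure_preserving
begin

section \<open>Correlations that are constant on a set of times\<close>

context
  fixes f g :: "'a \<Rightarrow> complex" and E :: "nat set" and d :: complex
  assumes f [measurable]: "f \<in> borel_measurable M" and g [measurable]: "g \<in> borel_measurable M"
    and f_bd: "\<And>x. cmod (f x) \<le> 1" and g_bd: "\<And>x. cmod (g x) \<le> 1"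
    and const: "\<And>j. j \<in> E \<Longrightarrow> correlation f g j = d"
begin

lemma parts_bounded: "\<bar>Re (f x)\<bar> \<le> 1" "\<bar>Im (f x)\<bar> \<le> 1" "\<bar>Re (g x)\<bar> \<le> 1" "\<bar>Im (g x)\<bar> \<le> 1"
  using f_bd[of x] g_bd[of x] abs_Re_le_cmod[of "f x"] abs_Im_le_cmod[of "f x"]
    abs_Re_le_cmod[of "g x"] abs_Im_le_cmod[of "g x"] by linarith+

lemma ergodic_constant_correlation:
  assumes erg: "ergodic_measure T M" and F: "folner_sequence F" and E: "has_density F E 1"
  shows "d = 0"
proof -
  have lim: "(\<lambda>m. average (F m) (\<lambda>j. correlation u v j)) \<longlonglongrightarrow> 0" and bd: "\<bar>correlation u v j\<bar> \<le> 2"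
    if "u \<in> {\<lambda>x. Re (f x), \<lambda>x. Im (f x)}" "v \<in> {\<lambda>x. Re (g x), \<lambda>x. Im (g x)}" for u v j
    using correlation_average_tendsto_0[OF erg F, of u v 1 1] abs_correlation_le[of u v 1 1 j] that parts_bounded
    by auto
  have "Re d = 0"
  proof (rule density_one_average[OF F E])
    show "(\<lambda>m. average (F m) (\<lambda>j. Re (correlation f g j))) \<longlonglongrightarrow> 0"
      unfolding correlation_complex(1)[OF f g f_bd g_bd] average_diff
      by (rule tendsto_eq_rhs[OF tendsto_diff[OF lim lim]]) auto
    \<comment> \<open>Two real correlations occur, each bounded by 2 according to
      \<open>abs_correlation_le\<close> with \<open>K = L = 1\<close>.\<close>
    show "\<bar>Re (correlation f g j)\<bar> \<le> 4" for j
      unfolding correlation_complex(1)[OF f g f_bd g_bd]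
      by (rule order_trans[OF abs_triangle_ineq4], rule order_trans[OF add_mono[OF bd bd]]) auto
  qed (simp add: const)
  moreover have "Im d = 0"
  proof (rule density_one_average[OF F E])
    show "(\<lambda>m. average (F m) (\<lambda>j. Im (correlation f g j))) \<longlonglongrightarrow> 0"
      unfolding correlation_complex(2)[OF f g f_bd g_bd] average_add
      by (intro tendsto_add_zero lim) auto
    show "\<bar>Im (correlation f g j)\<bar> \<le> 4" for j
      unfolding correlation_complex(2)[OF f g f_bd g_bd]
      by (rule order_trans[OF abs_triangle_ineq], rule order_trans[OF add_mono[OF bd bd]]) auto
  qed (simp add: const)
  ultimately show ?thesis by (simp add: complex_eq_iff)
qed

text \<open>The squared modulus is at most twice the sum of the four squared real correlations, and
  each of these averages to 0. Squares are used because under mere positive upper density signed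
  values off \<open>E\<close> could cancel those on \<open>E\<close>.\<close>

lemma weakly_mixing_constant_correlation:
  assumes wm: "weakly_mixing T M" and F: "folner_sequence F" and E: "upper_density F E > 0"
  shows "d = 0"
proof -
  have lim: "(\<lambda>m. average (F m) (\<lambda>j. (correlation u v j)\<^sup>2)) \<longlonglongrightarrow> 0"
    if "u \<in> {\<lambda>x. Re (f x), \<lambda>x. Im (f x)}" "v \<in> {\<lambda>x. Re (g x), \<lambda>x. Im (g x)}" for u v
    using weakly_mixing_average_tendsto_0[OF wm F, of u v 1 1] that parts_bounded by auto
  let ?C = "\<lambda>u v j. (correlation (\<lambda>x. u (f x)) (\<lambda>x. v (g x)) j)\<^sup>2"
  let ?S = "\<lambda>j. 2 * ((?C Re Re j + ?C Im Im j) + (?C Re Im j + ?C Im Re j))"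
  have sum: "(\<lambda>m. average (F m) ?S) \<longlonglongrightarrow> 0"
    unfolding average_cmult average_add
    by (intro tendsto_mult_right_zero tendsto_add_zero lim) auto
  have "(cmod (correlation f g j))\<^sup>2 \<le> ?S j" for j
  proof -
    have "(a - b)\<^sup>2 + (c + e)\<^sup>2 \<le> 2 * ((a\<^sup>2 + b\<^sup>2) + (c\<^sup>2 + e\<^sup>2))" for a b c e :: real
    proof -
      have "2 * ((a\<^sup>2 + b\<^sup>2) + (c\<^sup>2 + e\<^sup>2)) - ((a - b)\<^sup>2 + (c + e)\<^sup>2) = (a + b)\<^sup>2 + (c - e)\<^sup>2"
        by (simp add: power2_eq_square algebra_simps)
      then show ?thesis
        by (metis diff_ge_0_iff_ge add_nonneg_nonneg zero_le_power2)
    qed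
    then show ?thesis
      unfolding cmod_power2 correlation_complex[OF f g f_bd g_bd] .
  qed
  then have "average (F m) (\<lambda>j. (cmod (correlation f g j))\<^sup>2) \<le> average (F m) ?S" for m
    by (intro average_mono)
  moreover have "average (F m) (\<lambda>j. (cmod (correlation f g j))\<^sup>2) \<ge> 0" for m
    by (simp add: average_def sum_nonneg)
  ultimately have "(\<lambda>m. average (F m) (\<lambda>j. (cmod (correlation f g j))\<^sup>2)) \<longlonglongrightarrow> 0"
    by (intro tendsto_sandwich[OF _ _ tendsto_const sum] always_eventually) auto
  then have "(cmod d)\<^sup>2 = 0"
    by (rule upper_density_average[OF F E]) (auto simp: const)
  then show ?thesis by simp
qed

lemma strongly_mixing_constant_correlation:
  assumes sm: "strongly_mixing T M" and E: "infinite E"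
  shows "d = 0"
proof -
  have lim: "(\<lambda>j. correlation u v j) \<longlonglongrightarrow> 0"
    if "u \<in> {\<lambda>x. Re (f x), \<lambda>x. Im (f x)}" "v \<in> {\<lambda>x. Re (g x), \<lambda>x. Im (g x)}" for u v
    using strongly_mixing_correlation_tendsto_0[OF sm, of u v 1 1] that parts_bounded by auto
  have "(\<lambda>j. Re (correlation f g j)) \<longlonglongrightarrow> 0"
    unfolding correlation_complex(1)[OF f g f_bd g_bd]
    by (rule tendsto_eq_rhs[OF tendsto_diff[OF lim lim]]) auto
  moreover have "(\<lambda>j. Im (correlation f g j)) \<longlonglongrightarrow> 0"
    unfolding correlation_complex(2)[OF f g f_bd g_bd]
    by (intro tendsto_add_zero lim) auto
  ultimately have "correlation f g \<longlonglongrightarrow> 0"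
    by (simp add: tendsto_complex_iff)
  \<comment> \<open>Convergence along all times restricts to the increasing enumeration of the
    infinite set \<open>E\<close>, where the value is constantly \<open>d\<close>.\<close>
  then have "(\<lambda>n. correlation f g (enumerate E n)) \<longlonglongrightarrow> 0"
    using LIMSEQ_subseq_LIMSEQ[OF _ strict_mono_enumerate[OF E]] by (simp add: comp_def)
  then have "(\<lambda>n :: nat. d) \<longlonglongrightarrow> 0"
    by (simp add: const enumerate_in_set[OF E])
  then show ?thesis by (simp add: LIMSEQ_const_iff)
qed

end

section \<open>Atoms of mixing maps\<close>

lemma atom_correlation_bounded_below:
  assumes x: "{x} \<in> sets M" and p: "measure M {x} \<noteq> 0" "measure M {x} \<noteq> 1"
  shows "\<exists>\<delta>>0. \<forall>j. \<delta> \<le> (correlation (indicat_real {x}) (indicat_real {x}) j)\<^sup>2"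
proof -
  define p where "p = measure M {x}"
  have "x \<in> space M" using sets.sets_into_space[OF x] by simp
  have "correlation (indicat_real {x}) (indicat_real {x}) j \<in> {p - p * p, - (p * p)}" for j
  proof -
    \<comment> \<open>Only \<open>y = x\<close> can contribute, and it does so exactly when
      \<open>x\<close> returns to itself at time \<open>j\<close>; hence the two possible values
      \<open>p - p * p\<close> and \<open>- (p * p)\<close>.\<close>
    have "indicat_real {x} ((T ^^ j) y) * indicat_real {x} y = (if (T ^^ j) x = x then 1 else 0) * indicat_real {x} y" for y
      by (auto simp: indicator_def)
    then have "(\<integral>y. indicat_real {x} ((T ^^ j) y) * indicat_real {x} y \<partial>M) = (if (T ^^ j) x = x then 1 else 0) * p"
      using x \<open>x \<in> space M\<close> by (simp only:) (simp add: p_def)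
    then show ?thesis using x \<open>x \<in> space M\<close> by (simp add: correlation_def p_def)
  qed
  then have "min ((p - p * p)\<^sup>2) ((p * p)\<^sup>2) \<le> (correlation (indicat_real {x}) (indicat_real {x}) j)\<^sup>2" for j
    using insert_iff by (smt (verit) empty_iff power2_minus)
  moreover have "min ((p - p * p)\<^sup>2) ((p * p)\<^sup>2) > 0"
    using p by (simp add: p_def)
  ultimately show ?thesis by blast
qed

lemma weakly_mixing_atom:
  assumes "weakly_mixing T M" and F: "folner_sequence F" and x: "{x} \<in> sets M" "measure M {x} \<noteq> 0"
  shows "measure M {x} = 1"
proof (rule ccontr)
  assume "measure M {x} \<noteq> 1"
  then obtain \<delta> where \<delta>: "\<delta> > 0" "\<And>j. \<delta> \<le> (correlation (indicat_real {x}) (indicat_real {x}) j)\<^sup>2"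
    using atom_correlation_bounded_below[OF x] by blast
  let ?c = "\<lambda>j. (correlation (indicat_real {x}) (indicat_real {x}) j)\<^sup>2"
  have "(\<lambda>m. average (F m) ?c) \<longlonglongrightarrow> 0"
    using assms by (intro weakly_mixing_average_tendsto_0[where K = 1 and L = 1]) auto
  moreover have "\<delta> \<le> average (F m) ?c" for m
    using average_mono[of "F m" "\<lambda>_. \<delta>" ?c] \<delta> F by (auto simp: average_const folner_sequence_def)
  ultimately have "\<delta> \<le> 0" by (intro LIMSEQ_le_const) auto
  with \<delta> show False by simp
qed

lemma strongly_mixing_atom:
  assumes "strongly_mixing T M" and x: "{x} \<in> sets M" "measure M {x} \<noteq> 0"
  shows "measure M {x} = 1"
proof (rule ccontr)
  assume "measure M {x} \<noteq> 1"
  then obtain \<delta> where \<delta>: "\<delta> > 0" "\<And>j. \<delta> \<le> (correlation (indicat_real {x}) (indicat_real {x}) j)\<^sup>2"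
    using atom_correlation_bounded_below[OF x] by blast
  have "correlation (indicat_real {x}) (indicat_real {x}) \<longlonglongrightarrow> 0"
    using assms by (intro strongly_mixing_correlation_tendsto_0[where K = 1 and L = 1]) auto
  then have "(\<lambda>j. (correlation (indicat_real {x}) (indicat_real {x}) j)\<^sup>2) \<longlonglongrightarrow> 0\<^sup>2"
    by (rule tendsto_power)
  then have "\<delta> \<le> 0\<^sup>2" by (rule LIMSEQ_le_const) (use \<delta> in auto)
  with \<delta> show False by simp
qed

end

section \<open>From Fourier coefficients to the measure itself\<close>

lemma eq_returnI:
  fixes M :: "'a::t1_space measure"
  assumes M: "borel_probability M" and x: "measure M {x} = 1"
  shows "M = return borel x"
proof (rule measure_eqI)
  interpret prob_space M using M by (simp add: borel_probability_def)
  show sets: "sets M = sets (return borel x)" using M by (simp add: borel_probability_def)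
  fix A assume A: "A \<in> sets M"
  have x_sets: "{x} \<in> sets M" using sets by simp
  have "AE y in M. y = x" using x x_sets by (subst (asm) prob_eq_1) auto
  then have "AE y in M. y \<in> A \<longleftrightarrow> x \<in> A" by eventually_elim simp
  then have "measure M A = indicator A x"
    using A prob_eq_1[OF A] prob_eq_0[OF A] by (cases "x \<in> A") auto
  then show "emeasure M A = emeasure (return borel x) A"
    using A sets by (simp add: emeasure_eq_measure ennreal_indicator)
qed

text \<open>Invariance under the map of \<open>matrix_power A j + C\<close> equates the mean of the
  character \<open>k\<close> with that of its pullback, which splits into the character
  \<open>k\<close> at time \<open>j\<close> and the character \<open>k v* C\<close>. The resulting
  value does not depend on \<open>j\<close>.\<close>

lemma char_correlation:
  fixes \<mu> :: "'n::finite torus measure"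
  assumes \<mu>: "borel_probability \<mu>" and inv: "invariant_measure (torus_map A) \<mu>"
    and shift: "invariant_measure (torus_map (matrix_power A j + C)) \<mu>"
  shows "measure_preserving.correlation \<mu> (torus_map A) (torus_char k) (torus_char (k v* C)) j
    = (\<integral>x. torus_char k x \<partial>\<mu>) - (\<integral>x. torus_char k x \<partial>\<mu>) * (\<integral>x. torus_char (k v* C) x \<partial>\<mu>)"
proof -
  interpret prob_space \<mu> using \<mu> by (simp add: borel_probability_def)
  interpret A: measure_preserving \<mu> "torus_map A" by unfold_locales (rule inv)
  interpret S: measure_preserving \<mu> "torus_map (matrix_power A j + C)" by unfold_locales (rule shift)
  have "torus_char k \<in> borel_measurable \<mu>"
    using borel_probability_integrable[OF \<mu> continuous_torus_char] by auto
  then have "(\<integral>x. torus_char k x \<partial>\<mu>) = (\<integral>x. torus_char k (torus_map (matrix_power A j + C) x) \<partial>\<mu>)"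
    using S.integral_T_funpow[of "torus_char k" 1] by simp
  also have "\<dots> = (\<integral>x. torus_char k ((torus_map A ^^ j) x) * torus_char (k v* C) x \<partial>\<mu>)"
  proof -
    have "k v* (matrix_power A j + C) = k v* matrix_power A j + k v* C"
      by (simp add: vec_eq_iff vector_matrix_mult_def sum.distrib distrib_left)
    then show ?thesis
      by (simp add: torus_char_torus_map torus_char_funpow torus_char_add)
  qed
  finally show ?thesis by (simp add: A.correlation_def)
qed

lemma atom_or_lebesgue_torus:
  fixes \<mu> :: "'n::finite torus measure"
  assumes \<mu>: "borel_probability \<mu>" and inv: "invariant_measure (torus_map A) \<mu>"
    and cond: "ergodic_condition A \<mu> \<or> weakly_mixing_condition A \<mu> \<or> strongly_mixing_condition A \<mu>"
  shows "(\<exists>x. measure \<mu> {x} \<noteq> 0) \<or> \<mu> = lebesgue_torus"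
proof -
  interpret prob_space \<mu> using \<mu> by (simp add: borel_probability_def)
  interpret measure_preserving \<mu> "torus_map A" by unfold_locales (rule inv)
  have meas: "torus_char k \<in> borel_measurable \<mu>" for k
    using borel_probability_integrable[OF \<mu> continuous_torus_char] by auto
  let ?m = "\<lambda>k. \<integral>x. torus_char k x \<partial>\<mu>"
  \<comment> \<open>Each condition brings its own matrices; the existential reduces the three cases
    to one identity for the Fourier coefficients.\<close>
  have "\<exists>B. strongly_independent B \<and> (\<forall>k i. ?m k - ?m k * ?m (k v* B i) = 0)"
  proof -
    have bd: "cmod (torus_char k x) \<le> 1" for k :: "int ^ 'n" and x by simp
    from cond show ?thesis
    proof (elim disjE)
      assume "ergodic_condition A \<mu>"
      then obtain B F E where B: "strongly_independent B" and sh: "shift_invariant A B E \<mu>"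
        and *: "ergodic_measure (torus_map A) \<mu>" "folner_sequence F" "has_density F E 1"
        by (auto simp: ergodic_condition_def)
      have "?m k - ?m k * ?m (k v* B i) = 0" for k i
        using char_correlation[OF \<mu> inv] sh
        by (intro ergodic_constant_correlation[OF meas[of k] meas[of "k v* B i"] bd bd _ *]) (auto simp: shift_invariant_def)
      with B show ?thesis by blast
    next
      assume "weakly_mixing_condition A \<mu>"
      then obtain B F E where B: "strongly_independent B" and sh: "shift_invariant A B E \<mu>"
        and *: "weakly_mixing (torus_map A) \<mu>" "folner_sequence F" "upper_density F E > 0"
        by (auto simp: weakly_mixing_condition_def)
      have "?m k - ?m k * ?m (k v* B i) = 0" for k i
        using char_correlation[OF \<mu> inv] sh
        by (intro weakly_mixing_constant_correlation[OF meas[of k] meas[of "k v* B i"] bd bd _ *]) (auto simp: shift_invariant_def)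
      with B show ?thesis by blast
    next
      assume "strongly_mixing_condition A \<mu>"
      then obtain B E where B: "strongly_independent B" and sh: "shift_invariant A B E \<mu>"
        and *: "strongly_mixing (torus_map A) \<mu>" "infinite E"
        by (auto simp: strongly_mixing_condition_def)
      have "?m k - ?m k * ?m (k v* B i) = 0" for k i
        using char_correlation[OF \<mu> inv] sh
        by (intro strongly_mixing_constant_correlation[OF meas[of k] meas[of "k v* B i"] bd bd _ *]) (auto simp: shift_invariant_def)
      with B show ?thesis by blast
    qed
  qed
  then obtain B where B: "strongly_independent B" and eq: "\<And>k i. ?m k - ?m k * ?m (k v* B i) = 0"
    by blast
  show ?thesis
  proof (cases "\<forall>k. k \<noteq> 0 \<longrightarrow> ?m k = 0")
    case True
    then show ?thesis using eq_lebesgue_torusI[OF \<mu>] by blast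
  next
    case False
    then obtain k where k: "k \<noteq> 0" "?m k \<noteq> 0" by blast
    then have "?m (k v* B i) = 1" for i using eq[of k i] by simp
    then show ?thesis using strongly_independent_atom[OF \<mu> B k(1)] by blast
  qed
qed

theorem theorem1p4:
  fixes A :: "int ^ 'n ^ 'n" and \<mu> :: "'n torus measure"
  assumes "borel_probability \<mu>" and "invariant_measure (torus_map A) \<mu>"
  shows "(non_atomic \<mu> \<and>
            (ergodic_condition A \<mu> \<or> weakly_mixing_condition A \<mu> \<or> strongly_mixing_condition A \<mu>)
            \<longrightarrow> \<mu> = lebesgue_torus) \<and>
         (weakly_mixing_condition A \<mu> \<or> strongly_mixing_condition A \<mu>
            \<longrightarrow> (\<exists>x. \<mu> = return borel x) \<or> \<mu> = lebesgue_torus)"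
proof (intro conjI impI)
  interpret prob_space \<mu> using assms by (simp add: borel_probability_def)
  interpret measure_preserving \<mu> "torus_map A" by unfold_locales (rule assms)
  have sets: "sets \<mu> = sets borel" using assms by (simp add: borel_probability_def)
  then have space: "space \<mu> = UNIV" by (simp add: sets_eq_imp_space_eq)
  {
    assume "non_atomic \<mu> \<and>
      (ergodic_condition A \<mu> \<or> weakly_mixing_condition A \<mu> \<or> strongly_mixing_condition A \<mu>)"
    then show "\<mu> = lebesgue_torus"
      using atom_or_lebesgue_torus[OF assms] by (auto simp: non_atomic_def space)
  next
    assume cond: "weakly_mixing_condition A \<mu> \<or> strongly_mixing_condition A \<mu>"
    \<comment> \<open>In the weakly mixing case the Foelner sequence contained in the condition also
      serves \<open>weakly_mixing_atom\<close>.\<close>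
    have "measure \<mu> {x} = 1" if "measure \<mu> {x} \<noteq> 0" for x
      using cond weakly_mixing_atom[OF _ _ _ that] strongly_mixing_atom[OF _ _ that]
      by (auto simp: weakly_mixing_condition_def strongly_mixing_condition_def sets)
    then show "(\<exists>x. \<mu> = return borel x) \<or> \<mu> = lebesgue_torus"
      using atom_or_lebesgue_torus[OF assms] cond eq_returnI[OF assms(1)] by blast
  }
qed

end
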